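(* Let $Q=[0,1]^d\subset\mathbb{R}^d$, and let $|\cdot|$ be a fixed norm on $\mathbb{R}^d$. Let $X$ be a Banach space of functions on $Q$ which embeds continuously into $C(Q)$ (with the supremum norm) and for which there is a constant $C_X$ such that the Monte-Carlo estimate \[ \mathbb{E} \left\{\sup_{\phi \in B^X} \left[\frac1n\sum_{i=1}^n\phi(X_i) - \int_Q\phi(x)\,\mathrm{d}x\right]\right\} \leq \frac{C_X}{\sqrt{n}} \] holds for all $n\in\mathbb{N}$, where $X_1,\dots,X_n$ are independent and uniformly distributed on $Q$. Then there exists a $1$-Lipschitz function $\phi$ on $Q$ such that \[ \limsup_{t\to\infty} \left(t^\gamma\,\inf_{\|f\|_X \leq t}\|\phi - f\|_{L^2(Q)}^2\right) = \infty \] for all $\gamma> \frac{4}{d-2}$.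
   Context: $B^X$ denotes the closed unit ball of $X$. Integrals and $L^2(Q)$ are with respect to Lebesgue measure. "$1$-Lipschitz" means $|\phi(x)-\phi(y)|\le |x-y|$ for all $x,y\in Q$, with respect to the fixed norm on $\mathbb{R}^d$.
   Formalization: The dimension is assumed to satisfy d ≥ 3: for d = 2 the exponent 4/(d−2) is undefined, and for d = 1 the claim fails at γ = 0, since the infimum is at most the squared L² norm of φ. *)

theory Defs
  imports "HOL-Probability.Probability"
begin

abbreviation unit_cube :: "(real ^ 'd) set" where
  "unit_cube \<equiv> cbox 0 1"

definition is_norm :: "('a::real_vector \<Rightarrow> real) \<Rightarrow> bool" where
  "is_norm N \<longleftrightarrow>
     (\<forall>x. N x = 0 \<longleftrightarrow> x = 0) \<and>
     (\<forall>c x. N (c *\<^sub>R x) = \<bar>c\<bar> * N x) \<and>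
     (\<forall>x y. N (x + y) \<le> N x + N y)"

(* A normed space of functions on S is a normed space 'x together with an evaluation map val, where
   val f x is the value of the element f at the point x. Values at points outside S carry no meaning
   and are unconstrained. The third conjunct says that an element is determined by its values on S;
   the last one is continuity of the inclusion into C(S) with the supremum norm. *)
definition function_space_embedded_in_C ::
    "'a::topological_space set \<Rightarrow> ('x::real_normed_vector \<Rightarrow> 'a \<Rightarrow> real) \<Rightarrow> bool" where
  "function_space_embedded_in_C S val \<longleftrightarrow>
     (\<forall>x\<in>S. linear (\<lambda>f. val f x)) \<and>
     (\<forall>f. continuous_on S (val f)) \<and>
     (\<forall>f g. (\<forall>x\<in>S. val f x = val g x) \<longrightarrow> f = g) \<and>
     (\<exists>K. \<forall>f. \<forall>x\<in>S. \<bar>val f x\<bar> \<le> K * norm f)"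

(* The sample points are required to lie in S surely, not just almost surely, because the functions
   evaluated at them are only meaningful on S. *)
definition iid_uniform_on ::
    "'a::euclidean_space set \<Rightarrow> 'w measure \<Rightarrow> nat set \<Rightarrow> (nat \<Rightarrow> 'w \<Rightarrow> 'a) \<Rightarrow> bool" where
  "iid_uniform_on S M I X \<longleftrightarrow>
     prob_space M \<and>
     prob_space.indep_vars M (\<lambda>_. borel) X I \<and>
     (\<forall>i\<in>I. (\<forall>\<omega>\<in>space M. X i \<omega> \<in> S) \<and> distr M lborel (X i) = uniform_measure lborel S)"

definition L2_norm_on :: "'a::euclidean_space set \<Rightarrow> ('a \<Rightarrow> real) \<Rightarrow> real" where
  "L2_norm_on S g = sqrt (LINT x:S|lborel. (g x)\<^sup>2)"

end

(* For a partition of the cube into M = 2n equal cells, the sample of n points misses at least half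
   of the cells, so the Lipschitz function given by minus the distance to the complement of the
   missed cells has empirical mean 0 but integral at most -c M^(-1/d). Given the cells of the sample
   points, the points are independent and uniform in their cells; hence replacing this function by an
   L^2-approximation f changes the conditional expectation of the empirical mean by no more than a
   constant times the L^2 error, because the normalised cell counts form a density that is bounded in
   L^2 on average. If norm f <= t, the Monte-Carlo estimate bounds the expected gap by C t / sqrt n, so
   for t of order M^(1/2-1/d) some of these functions have L^2 distance of order
   M^(-1/d) = t^(-2/(d-2)) from the ball of radius t. A gliding hump over a rapidly growing sequence of
   grids combines them into one function. *)

theory Submission
  imports Defs "HOL-Real_Asymp.Real_Asymp"
begin

text \<open>L^2 closeness gives no control at individual points: a function built from the sample
  points themselves, such as minus the distance to them, could be matched in L^2 by an approximant
  with arbitrary values there. This is why the test functions depend on the sample only through the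
  cells it occupies. Averaging over the finitely many assignments of cells to sample points leaves
  integrals over cells, which L^2 closeness does control. Taking M proportional to n balances two
  demands: a fixed fraction of the cells must stay empty, yet two sample points must share a cell so
  rarely that the mean squared norm of the empirical density stays bounded (by 3 for M = 2n). The
  gliding hump loses powers of 2^k at its k-th term. With 2^(k^2+1) cells per side, such losses are
  smaller than any power of the grid size, so any excess of \<gamma> over 4/(d-2) absorbs them and
  one function serves all \<gamma> at once.\<close>

section \<open>Norms on finite-dimensional spaces, measurable suprema, counting\<close>

text \<open>The constant is the minimum of \<open>N\<close> over the Euclidean unit sphere, attained
  because \<open>N\<close> is Lipschitz. It lets the construction work with Euclidean distances: a
  function that is \<kappa>-Lipschitz for these is 1-Lipschitz for \<open>N\<close>.\<close>

lemma is_norm_lower_bound: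
  fixes N :: "'a::euclidean_space \<Rightarrow> real"
  assumes "is_norm N"
  obtains \<kappa> where "\<kappa> > 0" "\<And>x. \<kappa> * norm x \<le> N x"
proof -
  have zero: "N x = 0 \<longleftrightarrow> x = 0" and scale: "N (c *\<^sub>R x) = \<bar>c\<bar> * N x"
    and tri: "N (x + y) \<le> N x + N y" for x y c
    using assms unfolding is_norm_def by blast+
  have minus: "N (- x) = N x" for x
    using scale[of "- 1" x] by simp
  have pos: "N x \<ge> 0" for x
    using tri[of x "- x"] zero[of "x - x"] by (simp add: minus)
  have sum_le: "N (\<Sum>i\<in>I. g i) \<le> (\<Sum>i\<in>I. N (g i))" if "finite I" for I :: "'a set" and g
    using that by (induction I) (auto simp: zero[THEN iffD2] intro: order_trans[OF tri])
  have upper: "N x \<le> (\<Sum>b\<in>Basis. N b) * norm x" for x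
  proof -
    have "N x = N (\<Sum>b\<in>Basis. (x \<bullet> b) *\<^sub>R b)"
      by (simp add: euclidean_representation)
    also have "\<dots> \<le> (\<Sum>b\<in>Basis. N ((x \<bullet> b) *\<^sub>R b))"
      by (rule sum_le) simp
    also have "\<dots> \<le> (\<Sum>b\<in>Basis. norm x * N b)"
      by (intro sum_mono) (simp add: scale mult_right_mono Basis_le_norm pos)
    finally show ?thesis
      by (simp add: sum_distrib_left mult.commute)
  qed
  have "\<bar>N x - N y\<bar> \<le> N (x - y)" for x y
    using tri[of "x - y" y] tri[of "y - x" x] minus[of "x - y"] by (simp add: abs_le_iff)
  then have "\<bar>N x - N y\<bar> \<le> (\<Sum>b\<in>Basis. N b) * dist x y" for x y
    using upper[of "x - y"] by (metis dist_norm order_trans)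
  then have "(\<Sum>b\<in>Basis. N b)-lipschitz_on UNIV N"
    by (intro lipschitz_onI) (auto simp: dist_real_def intro: sum_nonneg pos)
  then have "continuous_on (sphere 0 1) N"
    using lipschitz_on_continuous_on continuous_on_subset by blast
  moreover have "sphere (0 :: 'a) 1 \<noteq> {}"
    by simp
  ultimately obtain u where u: "u \<in> sphere 0 1" "\<And>x. x \<in> sphere 0 1 \<Longrightarrow> N u \<le> N x"
    using continuous_attains_inf[OF compact_sphere] by metis
  show ?thesis
  proof
    have "u \<noteq> 0"
      using u(1) by auto
    then show "N u > 0"
      using pos[of u] zero[of u] by simp
    show "N u * norm x \<le> N x" for x
    proof (cases "x = 0")
      case False
      then have "N u \<le> N ((1 / norm x) *\<^sub>R x)"
        by (intro u) simp
      with False show ?thesis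
        by (simp add: scale field_simps)
    qed (simp add: pos)
  qed
qed

text \<open>An uncountable supremum of measurable functions can fail to be measurable. Here the set
  where \<open>g i\<close> exceeds \<open>a\<close> is the trace on \<open>T\<close> of an open set,
  so the superlevel set of the supremum is the preimage of one open union.\<close>

lemma borel_measurable_SUP_comp_continuous:
  fixes g :: "'i \<Rightarrow> 'y::topological_space \<Rightarrow> real"
  assumes "Z \<in> borel_measurable M" "\<And>\<omega>. \<omega> \<in> space M \<Longrightarrow> Z \<omega> \<in> T"
    and "\<And>i. i \<in> A \<Longrightarrow> continuous_on T (g i)"
    and "A \<noteq> {}" "\<And>y. y \<in> T \<Longrightarrow> bdd_above ((\<lambda>i. g i y) ` A)"
  shows "(\<lambda>\<omega>. SUP i\<in>A. g i (Z \<omega>)) \<in> borel_measurable M"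
  unfolding borel_measurable_iff_greater
proof
  fix a
  have "\<exists>U. open U \<and> (\<forall>y\<in>T. y \<in> U \<longleftrightarrow> a < g i y)" if i: "i \<in> A" for i
  proof -
    obtain U where "open U" "U \<inter> T = g i -` {a<..} \<inter> T"
      using assms(3)[OF i] continuous_on_open_invariant open_greaterThan by metis
    then show ?thesis
      by (intro exI[of _ U]) auto
  qed
  then obtain U where U: "\<And>i. i \<in> A \<Longrightarrow> open (U i)"
    "\<And>i y. i \<in> A \<Longrightarrow> y \<in> T \<Longrightarrow> y \<in> U i \<longleftrightarrow> a < g i y"
    by metis
  have "a < (SUP i\<in>A. g i (Z \<omega>)) \<longleftrightarrow> (\<exists>i\<in>A. Z \<omega> \<in> U i)" if "\<omega> \<in> space M" for \<omega>
    using U(2) assms(2)[OF that] less_cSUP_iff[OF assms(4) assms(5)] by blast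
  then have "{\<omega> \<in> space M. a < (SUP i\<in>A. g i (Z \<omega>))} = Z -` (\<Union>i\<in>A. U i) \<inter> space M"
    by blast
  also have "\<dots> \<in> sets M"
    by (intro measurable_sets[OF assms(1)] borel_open open_UN ballI U(1))
  finally show "{\<omega> \<in> space M. a < (SUP i\<in>A. g i (Z \<omega>))} \<in> sets M" .
qed

text \<open>Coordinate \<open>i\<close> is determined by coordinate \<open>k\<close>, so forgetting
  it is injective. In terms of probability, two independent uniformly chosen cells coincide with
  probability at most 1 / \<open>card B\<close>.\<close>

lemma card_PiE_eq_coords:
  assumes "finite I" "finite B" "i \<in> I" "k \<in> I" "i \<noteq> k"
  shows "card {j \<in> PiE I (\<lambda>_. B). j i = j k} \<le> card B ^ (card I - 1)"
proof -
  have "card {j \<in> PiE I (\<lambda>_. B). j i = j k} \<le> card (PiE (I - {i}) (\<lambda>_. B))"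
  proof (rule card_inj_on_le)
    show "inj_on (\<lambda>j. restrict j (I - {i})) {j \<in> PiE I (\<lambda>_. B). j i = j k}"
    proof (rule inj_onI, rule ext)
      fix j j' l
      assume *: "j \<in> {j \<in> PiE I (\<lambda>_. B). j i = j k}" "j' \<in> {j \<in> PiE I (\<lambda>_. B). j i = j k}"
        and eq: "restrict j (I - {i}) = restrict j' (I - {i})"
      have "j l = j' l" if "l \<in> I - {i}" for l
        using fun_cong[OF eq, of l] that by simp
      then show "j l = j' l"
        using * assms by (cases "l \<in> I"; cases "l = i") (auto simp: PiE_iff extensional_def)
    qed
    show "(\<lambda>j. restrict j (I - {i})) ` {j \<in> PiE I (\<lambda>_. B). j i = j k} \<subseteq> PiE (I - {i}) (\<lambda>_. B)"
      by (intro image_subsetI restrict_PiE_iff[THEN iffD2]) (auto dest: PiE_mem)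
  qed (use assms in \<open>auto simp: finite_PiE\<close>)
  also have "\<dots> = card B ^ (card I - 1)"
    using assms by (simp add: card_PiE)
  finally show ?thesis .
qed

section \<open>Integration over a set of volume 1 and sampling from its cells\<close>

lemma set_integrable_continuous_on_compact:
  fixes f :: "'a::euclidean_space \<Rightarrow> real"
  assumes "compact S" "continuous_on S f"
  shows "set_integrable lborel S f"
  using borel_integrable_compact[OF assms] by (simp add: set_integrable_def)

lemma emeasure_compact_eq_1:
  fixes S :: "'a::euclidean_space set"
  assumes "compact S" "measure lborel S = 1"
  shows "emeasure lborel S = 1"
  using emeasure_eq_ennreal_measure[of lborel S] emeasure_compact_finite[OF assms(1)] assms(2)
  by simp

lemma set_integral_le_const:
  fixes f :: "'a::euclidean_space \<Rightarrow> real"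
  assumes "compact S" "measure lborel S = 1" "continuous_on S f" "\<And>x. x \<in> S \<Longrightarrow> f x \<le> b"
  shows "(LINT x:S|lborel. f x) \<le> b"
proof -
  have "(LINT x:S|lborel. f x) \<le> (LINT x:S|lborel. b)"
    using assms by (intro set_integral_mono set_integrable_continuous_on_compact) auto
  also have "\<dots> = b"
    using assms(2) by (simp add: set_integral_const borel_compact[OF assms(1)] emeasure_compact_eq_1[OF assms(1,2)])
  finally show ?thesis .
qed

lemma expectation_uniform:
  fixes g :: "'a::euclidean_space \<Rightarrow> real"
  assumes "emeasure lborel S = 1" "S \<in> sets borel" "c \<in> sets borel" "c \<subseteq> S"
    and "distr M lborel X = uniform_measure lborel S" "X \<in> borel_measurable M"
    and "continuous_on S g"
  shows "(LINT \<omega>|M. indicator c (X \<omega>) * g (X \<omega>)) = (LINT x:c|lborel. g x)"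
proof -
  have h: "(\<lambda>x. indicator c x * g x) \<in> borel_measurable borel"
    using borel_measurable_continuous_on_indicator[of c g] assms continuous_on_subset by force
  have "(LINT \<omega>|M. indicator c (X \<omega>) * g (X \<omega>)) = (LINT x|distr M lborel X. indicator c x * g x)"
    using h assms by (subst integral_distr) auto
  also have "\<dots> = (LINT x|density lborel (\<lambda>x. ennreal (indicator S x)). indicator c x * g x)"
    unfolding assms(5) uniform_measure_def assms(1) by (simp add: ennreal_indicator divide_ennreal_def)
  also have "\<dots> = (LINT x|lborel. indicator S x * (indicator c x * g x))"
    using h assms by (subst integral_density) auto
  also have "\<dots> = (LINT x|lborel. indicator c x * g x)"
    using assms(4) by (intro Bochner_Integration.integral_cong) (auto split: split_indicator)
  finally show ?thesis
    by (simp add: set_lebesgue_integral_def)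
qed

text \<open>Conditionally on the cells containing the sample points, the points are independent and uniform
  in their cells; the competitor \<open>F j\<close> may therefore depend on the cells \<open>j\<close>.\<close>

lemma sampling_on_cells:
  fixes S :: "'a::euclidean_space set" and val :: "'x::real_normed_vector \<Rightarrow> 'a \<Rightarrow> real"
  assumes S: "compact S" "measure lborel S = 1"
    and emb: "function_space_embedded_in_C S val"
    and iid: "iid_uniform_on S M {1..} X"
    and n: "n \<ge> 1"
    and cells: "finite \<C>" "disjoint \<C>" "\<And>c. c \<in> \<C> \<Longrightarrow> open c \<and> c \<subseteq> S \<and> measure lborel c = v" "v > 0"
    and F: "\<And>j. j \<in> {1..n} \<rightarrow>\<^sub>E \<C> \<Longrightarrow> norm (F j) \<le> 1"
  shows "(\<Sum>j\<in>{1..n} \<rightarrow>\<^sub>E \<C>. v ^ n * ((\<Sum>i=1..n. LINT x:j i|lborel. val (F j) x) / (real n * v)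
            - (LINT x:S|lborel. val (F j) x)))
         \<le> (LINT \<omega>|M. (SUP f\<in>cball 0 1.
            (\<Sum>i=1..n. val f (X i \<omega>)) / real n - (LINT x:S|lborel. val f x)))"
proof -
  define I where "I = {1..n}"
  define P where "P = (I \<rightarrow>\<^sub>E \<C>)"
  define J where "J f = (LINT x:S|lborel. val f x)" for f
  define G where "G f z = (\<Sum>i\<in>I. val f (z i)) / real n - J f" for f and z :: "nat \<Rightarrow> 'a"
  define \<Psi> where "\<Psi> \<omega> = (SUP f\<in>cball 0 1. G f (\<lambda>i. X i \<omega>))" for \<omega>
  \<comment> \<open>The events encoded by \<open>hit j\<close> are disjoint for different
    \<open>j\<close> in \<open>P\<close>, and each has probability \<open>v ^ n\<close>. They need
    not exhaust the space: a sample point may lie outside all cells.\<close>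
  define hit where "hit j \<omega> = (\<Prod>k\<in>I. (indicator (j k) (X k \<omega>) :: real))" for j and \<omega>
  interpret prob_space M
    using iid by (simp add: iid_uniform_on_def)
  have indep: "indep_vars (\<lambda>_. borel) X {1..}"
    and X: "\<And>i \<omega>. i \<in> I \<Longrightarrow> \<omega> \<in> space M \<Longrightarrow> X i \<omega> \<in> S"
    and distr: "\<And>i. i \<in> I \<Longrightarrow> distr M lborel (X i) = uniform_measure lborel S"
    using iid by (auto simp: iid_uniform_on_def I_def)
  have X_meas: "X i \<in> borel_measurable M" if "i \<ge> 1" for i
    using indep that by (simp add: indep_vars_def)
  have emS: "emeasure lborel S = 1"
    using S by (rule emeasure_compact_eq_1)
  have S_sets: "S \<in> sets borel"
    using S by (simp add: borel_compact)
  have cell: "j k \<in> sets borel" "j k \<subseteq> S" "measure lborel (j k) = v" if "j \<in> P" "k \<in> I" for j k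
    using cells(3)[OF PiE_mem[OF that(1)[unfolded P_def] that(2)]] by auto
  have cont: "continuous_on S (val f)" for f
    using emb by (simp add: function_space_embedded_in_C_def)
  have val0: "val 0 x = 0" if "x \<in> S" for x
    using emb that by (auto simp: function_space_embedded_in_C_def dest: linear_0)
  obtain K where K: "\<And>f x. x \<in> S \<Longrightarrow> \<bar>val f x\<bar> \<le> K * norm f"
    using emb unfolding function_space_embedded_in_C_def by blast
  have K1: "\<bar>val f x\<bar> \<le> \<bar>K\<bar>" if "x \<in> S" "f \<in> cball 0 1" for f x
  proof -
    have "\<bar>val f x\<bar> \<le> \<bar>K\<bar> * norm f"
      using K[OF that(1), of f] by (meson abs_ge_self mult_right_mono norm_ge_zero order_trans)
    also have "\<dots> \<le> \<bar>K\<bar> * 1"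
      using that by (intro mult_left_mono) auto
    finally show ?thesis by simp
  qed
  have J_bound: "\<bar>J f\<bar> \<le> \<bar>K\<bar>" if "f \<in> cball 0 1" for f
  proof -
    have "(LINT x:S|lborel. - val f x) \<le> \<bar>K\<bar>"
      using K1[OF _ that] by (intro set_integral_le_const S continuous_intros cont) (auto simp: abs_le_iff)
    moreover have "J f \<le> \<bar>K\<bar>"
      unfolding J_def using K1[OF _ that] by (intro set_integral_le_const S cont) (auto simp: abs_le_iff)
    ultimately show ?thesis
      using set_integral_uminus[OF set_integrable_continuous_on_compact[OF S(1) cont], of f]
      by (simp add: J_def)
  qed
  have G_bound: "\<bar>G f z\<bar> \<le> 2 * \<bar>K\<bar>" if "f \<in> cball 0 1" "\<And>i. i \<in> I \<Longrightarrow> z i \<in> S" for f z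
  proof -
    have "\<bar>\<Sum>i\<in>I. val f (z i)\<bar> \<le> (\<Sum>i\<in>I. \<bar>K\<bar>)"
      using K1[OF that(2) that(1)] by (intro order_trans[OF sum_abs] sum_mono)
    then have "\<bar>(\<Sum>i\<in>I. val f (z i)) / real n\<bar> \<le> \<bar>K\<bar>"
      using n by (simp add: I_def field_simps)
    with J_bound[OF that(1)] show ?thesis
      unfolding G_def by linarith
  qed
  have G_bdd: "bdd_above ((\<lambda>f. G f z) ` cball 0 1)" if "\<And>i. i \<in> I \<Longrightarrow> z i \<in> S" for z
    using G_bound[OF _ that] by (intro bdd_aboveI2[of _ _ "2 * \<bar>K\<bar>"]) (auto simp: abs_le_iff)
  have G_le: "G f (\<lambda>i. X i \<omega>) \<le> \<Psi> \<omega>" if "\<omega> \<in> space M" "f \<in> cball 0 1" for f \<omega>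
    unfolding \<Psi>_def using that X by (intro cSUP_upper G_bdd) auto
  have "J 0 = (LINT x:S|lborel. (0::real))"
    unfolding J_def using S_sets val0 by (intro set_lebesgue_integral_cong) auto
  then have "J 0 = 0"
    by simp
  \<comment> \<open>The zero element competes in the supremum. This settles the samples compatible
    with no assignment \<open>j\<close>, where the sum over \<open>j\<close> vanishes.\<close>
  then have \<Psi>_nonneg: "\<Psi> \<omega> \<ge> 0" if "\<omega> \<in> space M" for \<omega>
    using G_le[OF that, of 0] X that by (simp add: G_def val0)

  \<comment> \<open>Samples are indexed from 1, whereas the identification of the product
    sigma-algebra with the Borel one concerns functions on all of \<open>nat\<close>. Index 0 is
    filled by \<open>X 1\<close>; \<open>G\<close> never reads it, so the supremum is still
    \<open>\<Psi>\<close>.\<close>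
  have "(\<lambda>\<omega>. \<lambda>i. X (max 1 i) \<omega>) \<in> measurable M (Pi\<^sub>M UNIV (\<lambda>_. borel))"
    by (intro measurable_PiM_single' X_meas) auto
  then have Z: "(\<lambda>\<omega>. \<lambda>i. X (max 1 i) \<omega>) \<in> borel_measurable M"
    by (simp add: sets_PiM_equal_borel cong: measurable_cong_sets)
  have "(\<lambda>\<omega>. SUP f\<in>cball 0 1. G f (\<lambda>i. X (max 1 i) \<omega>)) \<in> borel_measurable M"
  proof (rule borel_measurable_SUP_comp_continuous[OF Z, where T = "{z. \<forall>i\<in>I. z i \<in> S}"])
    show "continuous_on {z. \<forall>i\<in>I. z i \<in> S} (G f)" for f
      unfolding G_def using n
      by (intro continuous_intros continuous_on_compose2[OF cont]
          continuous_on_subset[OF continuous_on_product_coordinates]) auto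
    show "(\<lambda>i. X (max 1 i) \<omega>) \<in> {z. \<forall>i\<in>I. z i \<in> S}" if "\<omega> \<in> space M" for \<omega>
      using X that by (auto simp: I_def max_def)
  qed (auto intro: G_bdd)
  moreover have "(\<lambda>\<omega>. SUP f\<in>cball 0 1. G f (\<lambda>i. X (max 1 i) \<omega>)) = \<Psi>"
    by (auto simp: \<Psi>_def G_def I_def fun_eq_iff max_def intro!: SUP_cong sum.cong)
  ultimately have \<Psi>_meas: "\<Psi> \<in> borel_measurable M"
    by simp
  have \<Psi>_int: "integrable M \<Psi>"
  proof (rule integrable_const_bound[where B = "2 * \<bar>K\<bar>"])
    have "\<Psi> \<omega> \<le> 2 * \<bar>K\<bar>" if "\<omega> \<in> space M" for \<omega>
      unfolding \<Psi>_def using G_bound X that by (intro cSUP_least) (auto simp: abs_le_iff)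
    with \<Psi>_nonneg show "AE \<omega> in M. norm (\<Psi> \<omega>) \<le> 2 * \<bar>K\<bar>"
      by (intro AE_I2) auto
  qed fact

  \<comment> \<open>Independence turns the expectation of the product into a product of integrals
    over cells. With all \<open>g k\<close> equal to 1 this gives the probability of the event; with
    one of them replaced by \<open>val f\<close> it gives the expectation of \<open>val f\<close> at
    one sample point on that event.\<close>
  have prods: "integrable M (\<lambda>\<omega>. \<Prod>k\<in>I. indicator (j k) (X k \<omega>) * g k (X k \<omega>))"
    "(LINT \<omega>|M. (\<Prod>k\<in>I. indicator (j k) (X k \<omega>) * g k (X k \<omega>))) = (\<Prod>k\<in>I. LINT x:j k|lborel. g k x)"
    if j: "j \<in> P" and g: "\<And>k. k \<in> I \<Longrightarrow> continuous_on S (g k)"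
    for j and g :: "nat \<Rightarrow> 'a \<Rightarrow> real"
  proof -
    have h: "(\<lambda>x. indicator (j k) x * g k x) \<in> borel_measurable borel" if "k \<in> I" for k
      using borel_measurable_continuous_on_indicator[of "j k" "g k"] cell[OF j that] g[OF that]
        continuous_on_subset by force
    have Y: "indep_vars (\<lambda>_. borel) (\<lambda>k \<omega>. indicator (j k) (X k \<omega>) * g k (X k \<omega>)) I"
      by (rule indep_vars_compose2[OF indep_vars_subset[OF indep] h]) (auto simp: I_def)
    have int: "integrable M (\<lambda>\<omega>. indicator (j k) (X k \<omega>) * g k (X k \<omega>))" if k: "k \<in> I" for k
    proof -
      have "bounded (g k ` S)"
        using compact_continuous_image[OF g[OF k] S(1)] by (rule compact_imp_bounded)
      then obtain B where B: "\<And>x. x \<in> S \<Longrightarrow> \<bar>g k x\<bar> \<le> B"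
        by (auto simp: bounded_iff)
      show ?thesis
      proof (rule integrable_const_bound[where B = B])
        show "AE \<omega> in M. norm (indicator (j k) (X k \<omega>) * g k (X k \<omega>)) \<le> B"
          using B[OF X[OF k]] by (intro AE_I2) (auto split: split_indicator intro: order_trans[OF abs_ge_zero])
        show "(\<lambda>\<omega>. indicator (j k) (X k \<omega>) * g k (X k \<omega>)) \<in> borel_measurable M"
          using measurable_compose[OF X_meas h[OF k]] k by (simp add: I_def)
      qed
    qed
    have "finite I"
      by (simp add: I_def)
    then show "integrable M (\<lambda>\<omega>. \<Prod>k\<in>I. indicator (j k) (X k \<omega>) * g k (X k \<omega>))"
      using Y int by (rule indep_vars_integrable)
    have "(LINT \<omega>|M. (\<Prod>k\<in>I. indicator (j k) (X k \<omega>) * g k (X k \<omega>)))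
          = (\<Prod>k\<in>I. (LINT \<omega>|M. indicator (j k) (X k \<omega>) * g k (X k \<omega>)))"
      using \<open>finite I\<close> Y int by (rule indep_vars_lebesgue_integral)
    also have "\<dots> = (\<Prod>k\<in>I. LINT x:j k|lborel. g k x)"
      using emS S_sets cell[OF j] distr X_meas g
      by (intro prod.cong refl expectation_uniform) (auto simp: I_def)
    finally show "(LINT \<omega>|M. (\<Prod>k\<in>I. indicator (j k) (X k \<omega>) * g k (X k \<omega>)))
          = (\<Prod>k\<in>I. LINT x:j k|lborel. g k x)" .
  qed
  have vol: "(LINT x:j k|lborel. (1::real)) = v" if "j \<in> P" "k \<in> I" for j k
    using cell[OF that] emeasure_mono[of "j k" S lborel] S_sets emS
    by (subst set_integral_const) (auto simp: top_unique)
  have hit: "integrable M (hit j)" "(LINT \<omega>|M. hit j \<omega>) = v ^ n" if "j \<in> P" for j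
    using prods[OF that, of "\<lambda>_ _. 1"] vol[OF that] by (simp_all add: hit_def[abs_def] I_def)
  have hit_val: "integrable M (\<lambda>\<omega>. hit j \<omega> * val f (X i \<omega>))"
    "(LINT \<omega>|M. hit j \<omega> * val f (X i \<omega>)) = v ^ (n - 1) * (LINT x:j i|lborel. val f x)"
    if j: "j \<in> P" and i: "i \<in> I" for j f i
  proof -
    define g where "g k = (if k = i then val f else (\<lambda>_. 1))" for k
    have g: "continuous_on S (g k)" for k
      by (simp add: g_def cont)
    have eq: "(\<Prod>k\<in>I. indicator (j k) (X k \<omega>) * g k (X k \<omega>)) = hit j \<omega> * val f (X i \<omega>)" for \<omega>
    proof -
      have "(\<Prod>k\<in>I. g k (X k \<omega>)) = (\<Prod>k\<in>I. if k = i then val f (X i \<omega>) else 1)"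
        by (intro prod.cong) (auto simp: g_def)
      then show ?thesis
        using i by (simp add: prod.distrib hit_def I_def)
    qed
    have "(\<Prod>k\<in>I. LINT x:j k|lborel. g k x)
          = (LINT x:j i|lborel. g i x) * (\<Prod>k\<in>I - {i}. LINT x:j k|lborel. g k x)"
      using i by (intro prod.remove) (auto simp: I_def)
    also have "(\<Prod>k\<in>I - {i}. LINT x:j k|lborel. g k x) = (\<Prod>k\<in>I - {i}. v)"
      using vol[OF j] by (intro prod.cong) (auto simp: g_def)
    also have "\<dots> = v ^ (n - 1)"
      using i by (simp add: I_def)
    finally show "integrable M (\<lambda>\<omega>. hit j \<omega> * val f (X i \<omega>))"
      "(LINT \<omega>|M. hit j \<omega> * val f (X i \<omega>)) = v ^ (n - 1) * (LINT x:j i|lborel. val f x)"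
      using prods[of j g, OF j g] by (simp_all add: eq) (simp add: g_def)
  qed
  have hitG: "integrable M (\<lambda>\<omega>. hit j \<omega> * G f (\<lambda>i. X i \<omega>))"
    "(LINT \<omega>|M. hit j \<omega> * G f (\<lambda>i. X i \<omega>))
      = v ^ n * ((\<Sum>i\<in>I. LINT x:j i|lborel. val f x) / (real n * v) - J f)"
    if j: "j \<in> P" for j f
  proof -
    have eq: "hit j \<omega> * G f (\<lambda>i. X i \<omega>) = (\<Sum>i\<in>I. hit j \<omega> * val f (X i \<omega>)) / real n - hit j \<omega> * J f" for \<omega>
      by (simp add: G_def sum_distrib_left right_diff_distrib)
    have int: "integrable M (\<lambda>\<omega>. (\<Sum>i\<in>I. hit j \<omega> * val f (X i \<omega>)) / real n)"
      "integrable M (\<lambda>\<omega>. hit j \<omega> * J f)"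
      using hit_val(1)[OF j] hit(1)[OF j] by auto
    then show "integrable M (\<lambda>\<omega>. hit j \<omega> * G f (\<lambda>i. X i \<omega>))"
      by (simp add: eq)
    have vn: "v ^ n = v ^ (n - 1) * v"
      using n by (simp add: power_eq_if)
    have "(LINT \<omega>|M. hit j \<omega> * G f (\<lambda>i. X i \<omega>))
        = (\<Sum>i\<in>I. v ^ (n - 1) * (LINT x:j i|lborel. val f x)) / real n - v ^ n * J f"
      unfolding eq using int hit_val[OF j] hit[OF j] by (simp add: Bochner_Integration.integral_sum)
    also have "\<dots> = v ^ n * ((\<Sum>i\<in>I. LINT x:j i|lborel. val f x) / (real n * v) - J f)"
      unfolding vn sum_distrib_left[symmetric] right_diff_distrib using n cells(4) by simp
    finally show "(LINT \<omega>|M. hit j \<omega> * G f (\<lambda>i. X i \<omega>))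
        = v ^ n * ((\<Sum>i\<in>I. LINT x:j i|lborel. val f x) / (real n * v) - J f)" .
  qed
  have "finite P"
    using cells(1) by (simp add: P_def I_def finite_PiE)
  \<comment> \<open>At most one \<open>hit j\<close> is nonzero at a given \<omega>, so the sum
    selects a single element of the unit ball. This is why \<open>F\<close> may vary with
    \<open>j\<close> at no cost.\<close>
  have pointwise: "(\<Sum>j\<in>P. hit j \<omega> * G (F j) (\<lambda>i. X i \<omega>)) \<le> \<Psi> \<omega>" if \<omega>: "\<omega> \<in> space M" for \<omega>
  proof (cases "\<exists>j\<in>P. \<forall>k\<in>I. X k \<omega> \<in> j k")
    case True
    then obtain j where j: "j \<in> P" "\<forall>k\<in>I. X k \<omega> \<in> j k"
      by blast
    have "hit j' \<omega> = 0" if "j' \<in> P - {j}" for j'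
    proof -
      have j': "j' \<in> I \<rightarrow>\<^sub>E \<C>" "j' \<noteq> j" and j'': "j \<in> I \<rightarrow>\<^sub>E \<C>"
        using that j(1) by (auto simp: P_def)
      then obtain k where "k \<in> I" "j' k \<noteq> j k"
        using PiE_ext[OF j'(1) j''] by metis
      have "j k \<in> \<C>" "j' k \<in> \<C>"
        using PiE_mem[OF j'(1) \<open>k \<in> I\<close>] PiE_mem[OF j'' \<open>k \<in> I\<close>] by simp_all
      then have "j k \<inter> j' k = {}"
        using cells(2) \<open>j' k \<noteq> j k\<close> by (metis disjointD)
      then have "X k \<omega> \<notin> j' k"
        using j(2) \<open>k \<in> I\<close> by blast
      with \<open>k \<in> I\<close> show ?thesis
        unfolding hit_def by (intro prod_zero) (auto simp: I_def indicator_eq_0_iff intro!: bexI[of _ k])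
    qed
    then have "(\<Sum>j\<in>P. hit j \<omega> * G (F j) (\<lambda>i. X i \<omega>)) = hit j \<omega> * G (F j) (\<lambda>i. X i \<omega>)"
      using \<open>finite P\<close> j(1) by (subst sum.remove[of P j]) auto
    also have "\<dots> = G (F j) (\<lambda>i. X i \<omega>)"
      using j(2) by (simp add: hit_def)
    also have "\<dots> \<le> \<Psi> \<omega>"
      using G_le[OF \<omega>] F j(1) by (simp add: P_def I_def)
    finally show ?thesis .
  next
    case False
    then have "hit j \<omega> = 0" if "j \<in> P" for j
      using that unfolding hit_def by (intro prod_zero) (auto simp: I_def indicator_eq_0_iff)
    then show ?thesis
      using \<Psi>_nonneg[OF \<omega>] by simp
  qed
  have "(\<Sum>j\<in>P. v ^ n * ((\<Sum>i\<in>I. LINT x:j i|lborel. val (F j) x) / (real n * v) - J (F j)))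
        = (LINT \<omega>|M. (\<Sum>j\<in>P. hit j \<omega> * G (F j) (\<lambda>i. X i \<omega>)))"
    using hitG by (simp add: Bochner_Integration.integral_sum)
  also have "\<dots> \<le> (LINT \<omega>|M. \<Psi> \<omega>)"
    using hitG \<Psi>_int pointwise by (intro integral_mono) auto
  finally show ?thesis
    by (simp add: P_def I_def J_def \<Psi>_def G_def)
qed

section \<open>Functions that are hard to approximate at one scale\<close>

text \<open>Young's inequality takes the place of Cauchy-Schwarz: its right-hand side is linear in
  the two squares, so it can be integrated and averaged over cell assignments without any square
  roots.\<close>

lemma mult_le_weighted_squares:
  fixes a b \<delta> :: real
  assumes "\<delta> > 0"
  shows "a * b \<le> \<delta> / 2 * a\<^sup>2 + b\<^sup>2 / (2 * \<delta>)"
proof -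
  have "0 \<le> (\<delta> * a - b)\<^sup>2 / (2 * \<delta>)"
    using assms by simp
  also have "\<dots> = \<delta> / 2 * a\<^sup>2 + b\<^sup>2 / (2 * \<delta>) - a * b"
    using assms by (simp add: power2_eq_square field_simps)
  finally show ?thesis
    by simp
qed

text \<open>Boundedness makes the complement nonempty; \<open>infdist\<close> to the empty set is 0
  by convention.\<close>

lemma infdist_Compl_ge:
  fixes U :: "'a::euclidean_space set"
  assumes "bounded U" "ball x r \<subseteq> U"
  shows "r \<le> infdist x (- U)"
proof -
  have "- U \<noteq> {}"
    using assms(1) not_bounded_UNIV by (metis Compl_UNIV_eq double_complement)
  moreover have "r \<le> dist x y" if "y \<in> - U" for y
    using that assms(2) by (auto simp: subset_eq not_less)
  ultimately show ?thesis
    unfolding infdist_def by (auto intro: cINF_greatest)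
qed

text \<open>The expected squared \<open>L\<^sup>2\<close> norm of the empirical density on the cells, without
  its normalisation.\<close>

lemma sum_measure_Int_cells_le:
  fixes \<C> :: "'a::euclidean_space set set"
  assumes n: "n \<ge> 1"
    and cells: "finite \<C>" "disjoint \<C>" "card \<C> = 2 * n" "\<And>c. c \<in> \<C> \<Longrightarrow> measure lborel c = 1 / (2 * real n)"
  shows "(\<Sum>j\<in>{1..n} \<rightarrow>\<^sub>E \<C>. (1 / (2 * real n)) ^ n * (\<Sum>i=1..n. \<Sum>k=1..n. measure lborel (j i \<inter> j k))) \<le> 3 / 4"
proof -
  define P where "P = ({1..n} \<rightarrow>\<^sub>E \<C>)"
  define v where "v = 1 / (2 * real n)"
  have v: "v > 0" "v * (2 * real n) = 1"
    using n by (auto simp: v_def)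
  have finP: "finite P"
    using cells(1) by (simp add: P_def finite_PiE)
  have cardP: "real (card P) = (2 * real n) ^ n"
    by (simp add: P_def card_PiE cells(3))
  have one: "v ^ n * real (card P) = 1"
    unfolding cardP power_mult_distrib[symmetric] v(2) by simp
  \<comment> \<open>Two different sample points share a cell in a fraction of at most
    \<open>v\<close> of the assignments, and the common cell has volume \<open>v\<close>.\<close>
  have bound: "v ^ n * (\<Sum>j\<in>P. measure lborel (j i \<inter> j k)) \<le> (if i = k then v else v\<^sup>2)"
    if ik: "i \<in> {1..n}" "k \<in> {1..n}" for i k
  proof -
    have mem: "j i \<in> \<C>" "j k \<in> \<C>" if "j \<in> P" for j
      using PiE_mem[OF that[unfolded P_def]] ik by blast+
    have "measure lborel (j i \<inter> j k) = (if j i = j k then v else 0)" if "j \<in> P" for j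
      using disjointD[OF cells(2) mem[OF that]] cells(4)[OF mem(1)[OF that]]
      by (auto simp: v_def)
    then have "(\<Sum>j\<in>P. measure lborel (j i \<inter> j k)) = (\<Sum>j\<in>P. if j i = j k then v else 0)"
      by (intro sum.cong) auto
    also have "\<dots> = v * real (card {j \<in> P. j i = j k})"
      using finP by (simp add: sum.If_cases Int_def)
    finally have sum: "(\<Sum>j\<in>P. measure lborel (j i \<inter> j k)) = v * real (card {j \<in> P. j i = j k})" .
    show ?thesis
    proof (cases "i = k")
      case True
      then show ?thesis
        using one sum by (simp add: mult.left_commute)
    next
      case False
      have "card {j \<in> P. j i = j k} \<le> (2 * n) ^ (n - 1)"
        using card_PiE_eq_coords[OF _ cells(1) ik False] cells(3) by (simp add: P_def)
      then have "real (card {j \<in> P. j i = j k}) \<le> real ((2 * n) ^ (n - 1))"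
        by (rule of_nat_mono)
      then have "real (card {j \<in> P. j i = j k}) \<le> (2 * real n) ^ (n - 1)"
        by simp
      then have "v ^ n * (v * real (card {j \<in> P. j i = j k})) \<le> v ^ n * (v * (2 * real n) ^ (n - 1))"
        using v(1) by (intro mult_left_mono) auto
      also have "\<dots> = v\<^sup>2 * (v * (2 * real n)) ^ (n - 1)"
        using n by (cases n) (auto simp: power_mult_distrib power2_eq_square)
      finally show ?thesis
        using False v(2) by (simp add: sum)
    qed
  qed
  have "(\<Sum>j\<in>P. v ^ n * (\<Sum>i=1..n. \<Sum>k=1..n. measure lborel (j i \<inter> j k)))
      = (\<Sum>i=1..n. \<Sum>k=1..n. v ^ n * (\<Sum>j\<in>P. measure lborel (j i \<inter> j k)))"
    unfolding sum_distrib_left by (subst sum.swap, intro sum.cong refl, rule sum.swap)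
  \<comment> \<open>Charging \<open>v\<^sup>2\<close> to the diagonal as well completes the double
    sum to (n v)^2. With n v = 1/2 the total is 1/2 + 1/4.\<close>
  also have "\<dots> \<le> (\<Sum>i=1..n. \<Sum>k=1..n. (if i = k then v else 0) + v\<^sup>2)"
    using bound v(1) by (intro sum_mono order_trans[OF bound]) auto
  also have "\<dots> = real n * v + (real n * v)\<^sup>2"
    by (simp add: sum.distrib power2_eq_square algebra_simps)
  also have "\<dots> = 3 / 4"
    using n by (simp add: v_def power2_eq_square)
  finally show ?thesis
    by (simp add: P_def v_def)
qed

text \<open>If every test function had an approximant, averaging over the assignments would
  contradict \<open>gap\<close>; the proof does not tell which test function works. Here
  \<open>w\<close> is the volume of a core and \<open>r\<close> its clearance inside the cell, so n
  missed cells contribute \<kappa> r w n. The term 3\<delta> is the total cost of passing to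
  approximants: \<delta> in the integral over \<open>S\<close>, and on average \<delta>/2 +
  2\<delta> * 3/4 in the empirical mean.\<close>

lemma hard_lipschitz_function:
  fixes S :: "'a::euclidean_space set" and val :: "'x::real_normed_vector \<Rightarrow> 'a \<Rightarrow> real"
  assumes S: "compact S" "measure lborel S = 1"
    and emb: "function_space_embedded_in_C S val"
    and iid: "iid_uniform_on S M {1..} X"
    and n: "n \<ge> 1"
    and mc: "(LINT \<omega>|M. (SUP f\<in>cball 0 1.
            (\<Sum>i=1..n. val f (X i \<omega>)) / real n - (LINT x:S|lborel. val f x))) \<le> b"
    and cells: "finite \<C>" "disjoint \<C>" "card \<C> = 2 * n"
      "\<And>c. c \<in> \<C> \<Longrightarrow> open c \<and> c \<subseteq> S \<and> measure lborel c = 1 / (2 * real n)"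
    and cores: "\<And>c. c \<in> \<C> \<Longrightarrow> D c \<in> sets borel \<and> D c \<subseteq> c \<and> measure lborel (D c) = w"
      "\<And>c x. c \<in> \<C> \<Longrightarrow> x \<in> D c \<Longrightarrow> ball x r \<subseteq> c"
    and pos: "r > 0" "\<kappa> > 0" "t > 0" "\<delta> > 0"
    and gap: "t * b + 3 * \<delta> < \<kappa> * r * w * real n"
  shows "\<exists>\<phi>. (\<forall>x y. \<bar>\<phi> x - \<phi> y\<bar> \<le> \<kappa> * dist x y) \<and> (\<forall>x. \<bar>\<phi> x\<bar> \<le> \<kappa> * r) \<and>
    (\<forall>f. norm f \<le> t \<longrightarrow> \<delta>\<^sup>2 \<le> (LINT x:S|lborel. (\<phi> x - val f x)\<^sup>2))"
proof (rule ccontr)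
  define I where "I = {1..n}"
  define P where "P = (I \<rightarrow>\<^sub>E \<C>)"
  define v where "v = 1 / (2 * real n)"
  define U where "U j = \<Union>(\<C> - j ` I)" for j
  \<comment> \<open>The minus sign fits the one-sided Monte-Carlo estimate: empirical mean 0 minus a
    negative integral is positive. The cap at \<open>r\<close> loses nothing on the cores and yields
    the uniform bound \<kappa> r, which later controls the tails of the gliding hump.\<close>
  define \<phi> where "\<phi> j x = - (\<kappa> * min r (infdist x (- U j)))" for j and x :: 'a
  assume "\<not> ?thesis"
  then have no: "\<exists>f. norm f \<le> t \<and> (LINT x:S|lborel. (\<psi> x - val f x)\<^sup>2) < \<delta>\<^sup>2"
    if "\<And>x y. \<bar>\<psi> x - \<psi> y\<bar> \<le> \<kappa> * dist x y" "\<And>x. \<bar>\<psi> x\<bar> \<le> \<kappa> * r" for \<psi>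
    using that by (meson not_le)
  have "\<bar>\<phi> j x - \<phi> j y\<bar> \<le> \<kappa> * dist x y" for j x y
  proof -
    have "\<bar>min r (infdist x (- U j)) - min r (infdist y (- U j))\<bar> \<le> dist x y"
      using infdist_triangle_abs[of x "- U j" y] by linarith
    then have "\<kappa> * \<bar>min r (infdist x (- U j)) - min r (infdist y (- U j))\<bar> \<le> \<kappa> * dist x y"
      using pos by simp
    also have "\<kappa> * \<bar>min r (infdist x (- U j)) - min r (infdist y (- U j))\<bar> = \<bar>\<phi> j x - \<phi> j y\<bar>"
      using pos by (simp add: \<phi>_def abs_mult_pos' right_diff_distrib abs_minus_commute)
    finally show ?thesis .
  qed
  moreover have \<phi>_le: "- \<phi> j x \<ge> 0" and "\<bar>\<phi> j x\<bar> \<le> \<kappa> * r" for j x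
  proof -
    have "0 \<le> min r (infdist x (- U j))" "min r (infdist x (- U j)) \<le> r"
      using pos infdist_nonneg[of x "- U j"] by auto
    then have "0 \<le> \<kappa> * min r (infdist x (- U j))" "\<kappa> * min r (infdist x (- U j)) \<le> \<kappa> * r"
      using pos by auto
    then show "- \<phi> j x \<ge> 0" "\<bar>\<phi> j x\<bar> \<le> \<kappa> * r"
      by (simp_all add: \<phi>_def)
  qed
  ultimately have "\<exists>f. norm f \<le> t \<and> (LINT x:S|lborel. (\<phi> j x - val f x)\<^sup>2) < \<delta>\<^sup>2" for j
    by (intro no)
  then obtain f where f: "\<And>j. norm (f j) \<le> t" "\<And>j. (LINT x:S|lborel. (\<phi> j x - val (f j) x)\<^sup>2) < \<delta>\<^sup>2"
    by metis
  define g where "g j x = \<phi> j x - val (f j) x" for j x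
  have emS: "emeasure lborel S = 1"
    using S by (rule emeasure_compact_eq_1)
  have S_sets: "S \<in> sets borel"
    using S by (simp add: borel_compact)
  have fin_em: "emeasure lborel A < \<infinity>" if "A \<subseteq> S" for A
    using emeasure_mono[OF that, of lborel] S_sets emS by (auto simp: less_top[symmetric] top_unique)
  have v: "v > 0" "real n * v = 1 / 2"
    using n by (auto simp: v_def)
  have cell: "j i \<in> \<C>" "j i \<in> sets borel" "j i \<subseteq> S" if "j \<in> P" "i \<in> I" for j i
    using cells(4)[OF PiE_mem[OF that(1)[unfolded P_def] that(2)]] PiE_mem[OF that(1)[unfolded P_def] that(2)]
    by auto
  have cont_val: "continuous_on S (val h)" for h
    using emb by (simp add: function_space_embedded_in_C_def)
  have cont_\<phi>: "continuous_on S (\<phi> j)" for j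
    unfolding \<phi>_def by (intro continuous_intros)
  have cont_g: "continuous_on S (g j)" for j
    unfolding g_def by (intro continuous_intros cont_val cont_\<phi>)
  have int: "set_integrable lborel S (val h)" "set_integrable lborel S (\<phi> j)" "set_integrable lborel S (g j)"
    "set_integrable lborel S (\<lambda>x. (g j x)\<^sup>2)" for j h
    using S by (auto intro!: set_integrable_continuous_on_compact cont_val cont_\<phi> cont_g continuous_intros)
  have g_small: "(LINT x:S|lborel. (g j x)\<^sup>2) / (2 * \<delta>) \<le> \<delta> / 2" for j
    using f(2)[of j] pos by (simp add: g_def power2_eq_square field_simps)
  \<comment> \<open>This is the integral of the square of the function that counts the sample points
    assigned to the cell of x.\<close>
  define R where "R j = (\<Sum>i\<in>I. \<Sum>k\<in>I. measure lborel (j i \<inter> j k))" for j :: "nat \<Rightarrow> 'a set"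
  \<comment> \<open>On a hit cell the test function vanishes, so the approximant equals minus the
    error \<open>g j\<close>. Young's inequality is applied to 2 p g, with p the counting function;
    the leading factor 2 is 1 / (n v).\<close>
  have sample: "2 * (\<Sum>i\<in>I. LINT x:j i|lborel. val (f j) x) \<ge> - (2 * \<delta> * R j + \<delta> / 2)" if j: "j \<in> P" for j
  proof -
    have "(LINT x:j i|lborel. val (f j) x) = - (LINT x:j i|lborel. g j x)" if i: "i \<in> I" for i
    proof -
      have "x \<notin> U j" if "x \<in> j i" for x
      proof
        assume "x \<in> U j"
        then obtain c where "c \<in> \<C>" "c \<notin> j ` I" "x \<in> c"
          by (auto simp: U_def)
        with disjointD[OF cells(2) this(1) cell(1)[OF j i]] that i show False
          by blast
      qed
      then have "\<phi> j x = 0" if "x \<in> j i" for x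
        using that pos by (simp add: \<phi>_def)
      then have "(LINT x:j i|lborel. val (f j) x) = (LINT x:j i|lborel. - g j x)"
        using cell[OF j i] by (intro set_lebesgue_integral_cong) (auto simp: g_def)
      also have "\<dots> = - (LINT x:j i|lborel. g j x)"
        using cell[OF j i] by (intro set_integral_uminus set_integrable_subset[OF int(3)]) auto
      finally show ?thesis .
    qed
    then have "2 * (\<Sum>i\<in>I. LINT x:j i|lborel. val (f j) x) = - (\<Sum>i\<in>I. LINT x:j i|lborel. 2 * g j x)"
      by (simp add: sum_negf sum_distrib_left[symmetric])
    moreover have "(\<Sum>i\<in>I. LINT x:j i|lborel. 2 * g j x) \<le> 2 * \<delta> * R j + \<delta> / 2"
    proof -
      have ind: "integrable lborel (\<lambda>x. indicator (j i \<inter> j k) x :: real)" if "i \<in> I" "k \<in> I" for i k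
        using cell[OF j that(1)] cell[OF j that(2)] fin_em[of "j i \<inter> j k"]
        by (intro integrable_real_indicator) auto
      have g_int: "integrable lborel (\<lambda>x. indicator (j i) x * (2 * g j x))" if "i \<in> I" for i
        using set_integrable_subset[OF int(3)[of j], of "j i"] cell[OF j that]
        by (auto simp: set_integrable_def mult.left_commute)
      have g2_int: "integrable lborel (\<lambda>x. indicator S x * (g j x)\<^sup>2 / (2 * \<delta>))"
        using int(4)[of j] by (simp add: set_integrable_def)
      have "(\<Sum>i\<in>I. LINT x:j i|lborel. 2 * g j x) = (LINT x|lborel. (\<Sum>i\<in>I. indicator (j i) x * (2 * g j x)))"
        unfolding set_lebesgue_integral_def real_scaleR_def
        by (intro Bochner_Integration.integral_sum[symmetric] g_int)
      also have "\<dots> \<le> (LINT x|lborel. (2 * \<delta> * (\<Sum>i\<in>I. \<Sum>k\<in>I. indicator (j i \<inter> j k) x)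
          + indicator S x * (g j x)\<^sup>2 / (2 * \<delta>)))"
      proof (rule integral_mono)
        fix x
        define p where "p = (\<Sum>i\<in>I. indicator (j i) x :: real)"
        have p2: "(\<Sum>i\<in>I. \<Sum>k\<in>I. indicator (j i \<inter> j k) x) = p\<^sup>2"
          by (simp add: p_def power2_eq_square sum_product indicator_inter_arith)
        show "(\<Sum>i\<in>I. indicator (j i) x * (2 * g j x)) \<le> 2 * \<delta> * (\<Sum>i\<in>I. \<Sum>k\<in>I. indicator (j i \<inter> j k) x)
          + indicator S x * (g j x)\<^sup>2 / (2 * \<delta>)"
        proof (cases "x \<in> S")
          case True
          have "(\<Sum>i\<in>I. indicator (j i) x * (2 * g j x)) = 2 * p * g j x"
            by (simp add: p_def sum_distrib_right[symmetric])
          also have "\<dots> \<le> 2 * \<delta> * p\<^sup>2 + (g j x)\<^sup>2 / (2 * \<delta>)"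
            using mult_le_weighted_squares[OF pos(4), of "2 * p" "g j x"] by (simp add: power_mult_distrib)
          finally show ?thesis
            using True by (simp add: p2)
        next
          case False
          then have "(\<Sum>i\<in>I. indicator (j i) x * (2 * g j x)) = 0"
            using cell(3)[OF j] by (intro sum.neutral) (auto simp: indicator_def)
          then show ?thesis
            using pos False by (simp add: p2)
        qed
      qed (use ind g_int g2_int in auto)
      also have "\<dots> = 2 * \<delta> * R j + (LINT x:S|lborel. (g j x)\<^sup>2) / (2 * \<delta>)"
      proof -
        have "(LINT x|lborel. indicator S x * (g j x)\<^sup>2 / (2 * \<delta>)) = (LINT x:S|lborel. (g j x)\<^sup>2) / (2 * \<delta>)"
          by (simp add: set_lebesgue_integral_def)
        moreover have "(LINT x|lborel. 2 * \<delta> * (\<Sum>i\<in>I. \<Sum>k\<in>I. indicator (j i \<inter> j k) x)) = 2 * \<delta> * R j"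
          using ind by (simp add: R_def Bochner_Integration.integral_sum)
        ultimately show ?thesis
          using ind g2_int by (subst Bochner_Integration.integral_add) auto
      qed
      finally show ?thesis
        using g_small[of j] by linarith
    qed
    ultimately show ?thesis
      by linarith
  qed
  \<comment> \<open>The error \<open>g j\<close> costs at most \<delta>: Young's inequality against
    a constant on a set of volume 1 gives \<delta>/2 twice.\<close>
  have mean: "- (LINT x:S|lborel. val (f j) x) \<ge> \<kappa> * r * w * real n - \<delta>" if j: "j \<in> P" for j
  proof -
    have "(LINT x:S|lborel. val (f j) x) = (LINT x:S|lborel. \<phi> j x) - (LINT x:S|lborel. g j x)"
      using set_integral_diff(2)[OF int(2)[of j] int(3)[of j]] by (simp add: g_def)
    moreover have "- (LINT x:S|lborel. g j x) \<le> \<delta>"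
    proof -
      have "- (LINT x:S|lborel. g j x) = (LINT x:S|lborel. - g j x)"
        using int by (simp add: set_integral_uminus)
      also have "\<dots> \<le> (LINT x:S|lborel. \<delta> / 2 + (g j x)\<^sup>2 / (2 * \<delta>))"
        using mult_le_weighted_squares[OF pos(4), of "- 1" "g j x" for x] pos S
        by (intro set_integral_mono set_integrable_continuous_on_compact continuous_intros cont_g) auto
      also have "\<dots> = \<delta> / 2 + (LINT x:S|lborel. (g j x)\<^sup>2) / (2 * \<delta>)"
        using int(4)[of j] S emS S_sets set_integrable_continuous_on_compact[OF S(1), of "\<lambda>_. \<delta> / 2"]
        by (subst set_integral_add) (auto simp: set_integral_const)
      finally show ?thesis
        using g_small[of j] by simp
    qed
    moreover have "\<kappa> * r * w * real n \<le> - (LINT x:S|lborel. \<phi> j x)"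
    proof -
      define E where "E = (\<Union>c\<in>\<C> - j ` I. D c)"
      have D: "D c \<in> sets borel" "D c \<subseteq> S" "measure lborel (D c) = w" if "c \<in> \<C>" for c
        using cores(1)[OF that] cells(4)[OF that] by auto
      have E: "E \<in> sets borel" "E \<subseteq> S"
        unfolding E_def using D cells(1) by (auto intro!: sets.finite_UN)
      have "w \<ge> 0"
        using D(3) cells(3) n by (metis card.empty equals0I measure_nonneg mult_eq_0_iff not_one_le_zero zero_neq_numeral)
      have "card (j ` I) \<le> n"
        using card_image_le[of I j] by (simp add: I_def)
      then have "n \<le> card (\<C> - j ` I)"
        using diff_card_le_card_Diff[of "j ` I" \<C>] cells(3) by (simp add: I_def)
      then have "w * real n \<le> w * real (card (\<C> - j ` I))"
        using \<open>w \<ge> 0\<close> by (intro mult_left_mono) auto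
      also have "\<dots> = (\<Sum>c\<in>\<C> - j ` I. measure lborel (D c))"
        using D(3) by simp
      also have "\<dots> = measure lborel E"
        unfolding E_def
      proof (rule measure_UNION'[symmetric])
        show "pairwise (\<lambda>c c'. disjnt (D c) (D c')) (\<C> - j ` I)"
        proof (rule pairwiseI)
          fix c c' assume "c \<in> \<C> - j ` I" "c' \<in> \<C> - j ` I" "c \<noteq> c'"
          then have "c \<inter> c' = {}" "D c \<subseteq> c" "D c' \<subseteq> c'"
            using disjointD[OF cells(2)] cores(1) by auto
          then show "disjnt (D c) (D c')"
            unfolding disjnt_def by blast
        qed
        show "D c \<in> fmeasurable lborel" if "c \<in> \<C> - j ` I" for c
          using D(1,2)[of c] fin_em[of "D c"] that by (intro fmeasurableI) auto
      qed (simp add: cells(1))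
      finally have "\<kappa> * r * (w * real n) \<le> \<kappa> * r * measure lborel E"
        using pos by (intro mult_left_mono) auto
      also have "\<dots> = (LINT x:E|lborel. \<kappa> * r)"
        using E fin_em[OF E(2)] by (simp add: set_integral_const)
      also have "\<dots> \<le> (LINT x:E|lborel. - \<phi> j x)"
      proof (rule set_integral_mono)
        show "set_integrable lborel E (\<lambda>x. \<kappa> * r)"
          using set_integrable_subset[OF set_integrable_continuous_on_compact[OF S(1)], of "\<lambda>_. \<kappa> * r" E] E
          by auto
        show "set_integrable lborel E (\<lambda>x. - \<phi> j x)"
          using set_integrable_subset[OF set_integrable_continuous_on_compact[OF S(1)], of "\<lambda>x. - \<phi> j x" E] E
          by (auto intro!: continuous_intros cont_\<phi>)
        fix x assume "x \<in> E"
        then obtain c where "c \<in> \<C> - j ` I" "x \<in> D c"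
          by (auto simp: E_def)
        then have "ball x r \<subseteq> U j"
          using cores(2)[of c x] by (auto simp: U_def)
        moreover have "bounded (U j)"
          using bounded_subset[OF compact_imp_bounded[OF S(1)], of "U j"] cells(4) by (auto simp: U_def)
        ultimately have "r \<le> infdist x (- U j)"
          by (intro infdist_Compl_ge)
        then show "\<kappa> * r \<le> - \<phi> j x"
          by (simp add: \<phi>_def)
      qed
      also have "\<dots> \<le> (LINT x:S|lborel. - \<phi> j x)"
        unfolding set_lebesgue_integral_def
      proof (rule integral_mono)
        show "integrable lborel (\<lambda>x. indicat_real E x *\<^sub>R - \<phi> j x)"
          using set_integrable_subset[OF set_integrable_continuous_on_compact[OF S(1)], of "\<lambda>x. - \<phi> j x" E] E
          by (auto intro!: continuous_intros cont_\<phi> simp: set_integrable_def)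
        show "integrable lborel (\<lambda>x. indicat_real S x *\<^sub>R - \<phi> j x)"
          using set_integrable_continuous_on_compact[OF S(1), of "\<lambda>x. - \<phi> j x"]
          by (auto intro!: continuous_intros cont_\<phi> simp: set_integrable_def)
        show "indicat_real E x *\<^sub>R - \<phi> j x \<le> indicat_real S x *\<^sub>R - \<phi> j x" for x
          using E(2) \<phi>_le[of j x] by (auto simp: indicator_def)
      qed
      also have "\<dots> = - (LINT x:S|lborel. \<phi> j x)"
        using int by (simp add: set_integral_uminus)
      finally show ?thesis
        by (simp add: mult.assoc)
    qed
    ultimately show ?thesis
      by linarith
  qed
  \<comment> \<open>The approximants are scaled into the unit ball, where the Monte-Carlo estimate
    applies; linearity of evaluation brings the factor \<open>t\<close> back.\<close>
  have "t * (\<Sum>j\<in>P. v ^ n * ((\<Sum>i\<in>I. LINT x:j i|lborel. val ((1 / t) *\<^sub>R f j) x) / (real n * v)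
            - (LINT x:S|lborel. val ((1 / t) *\<^sub>R f j) x))) \<le> t * b"
  proof (rule mult_left_mono[OF order_trans[OF _ mc]])
    show "(\<Sum>j\<in>P. v ^ n * ((\<Sum>i\<in>I. LINT x:j i|lborel. val ((1 / t) *\<^sub>R f j) x) / (real n * v)
            - (LINT x:S|lborel. val ((1 / t) *\<^sub>R f j) x)))
        \<le> (LINT \<omega>|M. (SUP f\<in>cball 0 1.
            (\<Sum>i=1..n. val f (X i \<omega>)) / real n - (LINT x:S|lborel. val f x)))"
      unfolding P_def I_def
      using f(1) pos v(1)
      by (intro sampling_on_cells[OF S emb iid n cells(1,2)]) (auto simp: cells(4) v_def)
  qed (use pos in auto)
  also have "t * (\<Sum>j\<in>P. v ^ n * ((\<Sum>i\<in>I. LINT x:j i|lborel. val ((1 / t) *\<^sub>R f j) x) / (real n * v)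
            - (LINT x:S|lborel. val ((1 / t) *\<^sub>R f j) x)))
      = (\<Sum>j\<in>P. v ^ n * (2 * (\<Sum>i\<in>I. LINT x:j i|lborel. val (f j) x) - (LINT x:S|lborel. val (f j) x)))"
    (is "_ = ?lhs")
  proof -
    have scale: "(LINT x:A|lborel. val ((1 / t) *\<^sub>R f j) x) = (LINT x:A|lborel. val (f j) x) / t"
      if "A \<subseteq> S" "A \<in> sets borel" for A j
    proof -
      have "val ((1 / t) *\<^sub>R f j) x = val (f j) x / t" if "x \<in> S" for x
      proof -
        have "linear (\<lambda>f. val f x)"
          using emb that by (simp add: function_space_embedded_in_C_def)
        from linear_scale[OF this, of "1 / t" "f j"] show ?thesis
          by simp
      qed
      then have "(LINT x:A|lborel. val ((1 / t) *\<^sub>R f j) x) = (LINT x:A|lborel. val (f j) x / t)"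
        using that by (intro set_lebesgue_integral_cong) auto
      then show ?thesis
        by simp
    qed
    have sum_scale: "(\<Sum>i\<in>I. LINT x:j i|lborel. val ((1 / t) *\<^sub>R f j) x) = (\<Sum>i\<in>I. LINT x:j i|lborel. val (f j) x) / t"
      if "j \<in> P" for j
      unfolding sum_divide_distrib using cell[OF that] by (intro sum.cong scale) auto
    have "t * (v ^ n * (A / t / (real n * v) - B / t)) = v ^ n * (2 * A - B)" for A B
      unfolding v(2) using pos by (simp add: field_simps)
    then show ?thesis
      unfolding sum_distrib_left[of t]
      by (intro sum.cong refl) (simp only: sum_scale scale[OF order_refl S_sets])
  qed
  finally have upper: "?lhs \<le> t * b" .
  \<comment> \<open>The weights form a probability distribution on the assignments, as 2n disjoint
    cells of volume 1/(2n) fill \<open>S\<close> up to a null set.\<close>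
  have "v ^ n * real (card P) = 1"
    using n by (simp add: P_def I_def card_PiE cells(3) v_def power_one_over)
  moreover have "(\<Sum>j\<in>P. v ^ n * (K - 2 * \<delta> * R j)) = v ^ n * real (card P) * K - 2 * \<delta> * (\<Sum>j\<in>P. v ^ n * R j)" for K
    by (simp add: right_diff_distrib sum_subtractf sum_distrib_left mult_ac)
  ultimately have "\<kappa> * r * w * real n - 3 * \<delta> / 2 - 2 * \<delta> * (\<Sum>j\<in>P. v ^ n * R j)
      = (\<Sum>j\<in>P. v ^ n * (\<kappa> * r * w * real n - 3 * \<delta> / 2 - 2 * \<delta> * R j))"
    by simp
  also have "\<dots> \<le> ?lhs"
  proof (intro sum_mono mult_left_mono)
    show "\<kappa> * r * w * real n - 3 * \<delta> / 2 - 2 * \<delta> * R j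
        \<le> 2 * (\<Sum>i\<in>I. LINT x:j i|lborel. val (f j) x) - (LINT x:S|lborel. val (f j) x)" if "j \<in> P" for j
      using sample[OF that] mean[OF that] by linarith
  qed (use v in auto)
  finally have lower: "\<kappa> * r * w * real n - 3 * \<delta> / 2 - 2 * \<delta> * (\<Sum>j\<in>P. v ^ n * R j) \<le> ?lhs" .
  have "(\<Sum>j\<in>P. v ^ n * R j) \<le> 3 / 4"
    using sum_measure_Int_cells_le[OF n cells(1-3)] cells(4) by (simp add: P_def I_def R_def v_def)
  then have "2 * \<delta> * (\<Sum>j\<in>P. v ^ n * R j) \<le> 2 * \<delta> * (3 / 4)"
    using pos by (intro mult_left_mono) auto
  with lower upper gap show False
    by linarith
qed

section \<open>The gliding hump\<close>

text \<open>A substitute for the L^2 triangle inequality that stays with squared norms; its factor 2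
  is the source of the 1/4 and the 1/8 in the gliding hump.\<close>

lemma set_integral_power2_add_le:
  fixes f g :: "'a::euclidean_space \<Rightarrow> real"
  assumes S: "compact S" and f: "continuous_on S f" and g: "continuous_on S g"
  shows "(LINT x:S|lborel. (f x + g x)\<^sup>2) \<le> 2 * (LINT x:S|lborel. (f x)\<^sup>2) + 2 * (LINT x:S|lborel. (g x)\<^sup>2)"
proof -
  have "(f x + g x)\<^sup>2 \<le> 2 * (f x)\<^sup>2 + 2 * (g x)\<^sup>2" for x
    using zero_le_power2[of "f x - g x"] by (simp add: power2_eq_square algebra_simps)
  then have "(LINT x:S|lborel. (f x + g x)\<^sup>2) \<le> (LINT x:S|lborel. 2 * (f x)\<^sup>2 + 2 * (g x)\<^sup>2)"
    by (intro set_integral_mono set_integrable_continuous_on_compact S continuous_intros f g)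
  also have "\<dots> = 2 * (LINT x:S|lborel. (f x)\<^sup>2) + 2 * (LINT x:S|lborel. (g x)\<^sup>2)"
    by (subst set_integral_add)
      (auto intro!: set_integrable_continuous_on_compact S continuous_intros f g)
  finally show ?thesis .
qed

text \<open>If both \<open>\<Phi>\<close> and \<open>\<Phi> + \<epsilon>\<phi>\<close> were well approximated, so would be their difference.
  Hence each term \<open>\<epsilon>\<^sub>k\<phi>\<^sub>k\<close> can be either included or left out such that the partial sum
  is badly approximated.\<close>

lemma gliding_hump:
  fixes S :: "'a::euclidean_space set" and val :: "'x::real_normed_vector \<Rightarrow> 'a \<Rightarrow> real"
    and \<phi> :: "nat \<Rightarrow> 'a \<Rightarrow> real" and N :: "'a \<Rightarrow> real"
  assumes S: "compact S" "measure lborel S = 1"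
    and emb: "function_space_embedded_in_C S val"
    and lip: "\<And>k x y. \<bar>\<phi> k x - \<phi> k y\<bar> \<le> N (x - y)"
    and cont: "\<And>k. continuous_on S (\<phi> k)"
    and bound: "\<And>k x. \<bar>\<phi> k x\<bar> \<le> b k" "decseq b"
    and hard: "\<And>k f. norm f \<le> t k \<Longrightarrow> e k \<le> (LINT x:S|lborel. (\<phi> k x - val f x)\<^sup>2)"
  shows "\<exists>\<psi>. (\<forall>x y. \<bar>\<psi> x - \<psi> y\<bar> \<le> N (x - y)) \<and>
    (\<forall>k f. norm f \<le> (1/2) ^ Suc k * t k / 2 \<longrightarrow>
      (1/4) ^ Suc k * (e k / 8 - (b (Suc k))\<^sup>2) \<le> (LINT x:S|lborel. (\<psi> x - val f x)\<^sup>2))"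
proof -
  \<comment> \<open>These coefficients sum to 1, so the series inherits the Lipschitz bound
    \<open>N\<close> of its terms without loss.\<close>
  define \<epsilon> :: "nat \<Rightarrow> real" where "\<epsilon> k = (1/2) ^ Suc k" for k
  \<comment> \<open>The constants make two failures contradict \<open>hard\<close>: elements of norm
    at most \<epsilon> t / 2 differ by at most \<epsilon> t, and two squared errors below
    \<epsilon>^2 e / 4 combine to less than 2 (1/4 + 1/4) \<epsilon>^2 e.\<close>
  define bad where "bad k \<Phi> \<longleftrightarrow>
    (\<forall>f::'x. norm f \<le> \<epsilon> k * t k / 2 \<longrightarrow> (\<epsilon> k)\<^sup>2 * e k / 4 \<le> (LINT x:S|lborel. (\<Phi> x - val f x)\<^sup>2))" for k \<Phi>
  define \<Phi> where "\<Phi> = rec_nat (\<lambda>_. 0) (\<lambda>k \<Phi>. if bad k \<Phi> then \<Phi> else (\<lambda>x. \<Phi> x + \<epsilon> k * \<phi> k x))"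
  define a where "a k = (if bad k (\<Phi> k) then 0 else \<epsilon> k)" for k
  have \<Phi>_0: "\<Phi> 0 = (\<lambda>_. 0)" and \<Phi>_Suc: "\<Phi> (Suc k) x = \<Phi> k x + a k * \<phi> k x" for k x
    by (auto simp: \<Phi>_def a_def)
  have \<Phi>: "\<Phi> k x = (\<Sum>l<k. a l * \<phi> l x)" for k x
    by (induction k) (simp_all add: \<Phi>_0 \<Phi>_Suc)
  have \<epsilon>_pos: "\<epsilon> k > 0" for k
    by (simp add: \<epsilon>_def)
  have \<epsilon>_sums: "(\<lambda>l. \<epsilon> (l + k)) sums ((1/2) ^ k)" for k
  proof -
    have "(\<lambda>l. (1/2) ^ k * (1/2 :: real) ^ Suc l) sums ((1/2) ^ k * 1)"
      by (intro sums_mult power_half_series)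
    then show ?thesis
      by (simp add: \<epsilon>_def power_add mult_ac)
  qed
  have a: "0 \<le> a k" "a k \<le> \<epsilon> k" for k
    using \<epsilon>_pos[of k] by (auto simp: a_def)
  have cont_val: "continuous_on S (val f)" for f
    using emb by (simp add: function_space_embedded_in_C_def)
  have cont_\<Phi>: "continuous_on S (\<Phi> k)" for k
    unfolding \<Phi> by (intro continuous_intros cont)

  have bad: "bad k (\<Phi> (Suc k))" for k
  proof (cases "bad k (\<Phi> k)")
    case True
    then show ?thesis
      by (simp add: \<Phi>_def)
  next
    case False
    then obtain f where f: "norm f \<le> \<epsilon> k * t k / 2"
      "(LINT x:S|lborel. (\<Phi> k x - val f x)\<^sup>2) < (\<epsilon> k)\<^sup>2 * e k / 4"
      by (auto simp: bad_def not_le)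
    show ?thesis
      unfolding bad_def
    proof (intro allI impI)
      fix f' :: 'x assume f': "norm f' \<le> \<epsilon> k * t k / 2"
      define h where "h = (1 / \<epsilon> k) *\<^sub>R (f' - f)"
      have "norm (f' - f) \<le> \<epsilon> k * t k"
        using f(1) f' norm_triangle_ineq4[of f' f] by linarith
      then have "norm h \<le> t k"
        unfolding h_def norm_scaleR using \<epsilon>_pos[of k] by (simp add: field_simps)
      have "(\<epsilon> k)\<^sup>2 * e k \<le> (\<epsilon> k)\<^sup>2 * (LINT x:S|lborel. (\<phi> k x - val h x)\<^sup>2)"
        using hard[OF \<open>norm h \<le> t k\<close>] by (intro mult_left_mono) auto
      also have "\<dots> = (LINT x:S|lborel. (\<epsilon> k)\<^sup>2 * (\<phi> k x - val h x)\<^sup>2)"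
        by simp
      also have "\<dots> = (LINT x:S|lborel. ((\<Phi> (Suc k) x - val f' x) + (val f x - \<Phi> k x))\<^sup>2)"
      proof (intro set_lebesgue_integral_cong allI impI)
        fix x assume "x \<in> S"
        then have "linear (\<lambda>f. val f x)"
          using emb by (simp add: function_space_embedded_in_C_def)
        from linear_scale[OF this, of "1 / \<epsilon> k" "f' - f"] linear_diff[OF this, of f' f]
        have "\<epsilon> k * val h x = val f' x - val f x"
          unfolding h_def using \<epsilon>_pos[of k] by (simp del: scaleR_diff_right)
        then have "\<epsilon> k * (\<phi> k x - val h x) = (\<Phi> (Suc k) x - val f' x) + (val f x - \<Phi> k x)"
          using False by (simp add: \<Phi>_Suc a_def right_diff_distrib)
        then show "(\<epsilon> k)\<^sup>2 * (\<phi> k x - val h x)\<^sup>2 = ((\<Phi> (Suc k) x - val f' x) + (val f x - \<Phi> k x))\<^sup>2"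
          by (metis power_mult_distrib)
      qed (simp add: borel_compact S)
      also have "\<dots> \<le> 2 * (LINT x:S|lborel. (\<Phi> (Suc k) x - val f' x)\<^sup>2) + 2 * (LINT x:S|lborel. (val f x - \<Phi> k x)\<^sup>2)"
        by (intro set_integral_power2_add_le S continuous_intros cont_val cont_\<Phi>)
      finally show "(\<epsilon> k)\<^sup>2 * e k / 4 \<le> (LINT x:S|lborel. (\<Phi> (Suc k) x - val f' x)\<^sup>2)"
        using f(2) by (simp add: power2_commute)
    qed
  qed

  define \<psi> where "\<psi> x = (\<Sum>k. a k * \<phi> k x)" for x
  have b_nonneg: "b k \<ge> 0" for k
    using bound(1)[of k 0] by linarith
  have term_le: "norm (a l * \<phi> l x) \<le> \<epsilon> l * b k" if "k \<le> l" for k l x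
    using a[of l] bound(1)[of l x] decseqD[OF bound(2) that] \<epsilon>_pos[of l]
    by (auto simp: abs_mult intro!: mult_mono)
  have summ: "summable (\<lambda>k. a k * \<phi> k x)" for x
  proof (rule summable_comparison_test')
    show "summable (\<lambda>k. \<epsilon> k * b 0)"
      using \<epsilon>_sums[of 0] by (intro summable_mult2) (auto simp: sums_iff)
    show "norm (a k * \<phi> k x) \<le> \<epsilon> k * b 0" for k
      by (rule term_le) simp
  qed
  \<comment> \<open>Since \<open>b\<close> decreases, \<open>b k\<close> bounds all later terms, and
    the coefficients from index k on sum to at most (1/2)^k.\<close>
  have tail: "\<bar>\<psi> x - \<Phi> k x\<bar> \<le> (1/2) ^ k * b k" for k x
  proof -
    have "\<psi> x - \<Phi> k x = (\<Sum>l. a (l + k) * \<phi> (l + k) x)"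
      unfolding \<psi>_def \<Phi> using suminf_split_initial_segment[OF summ, of x k] by simp
    moreover have "norm (\<Sum>l. a (l + k) * \<phi> (l + k) x) \<le> (\<Sum>l. \<epsilon> (l + k) * b k)"
    proof (rule norm_suminf_le)
      show "summable (\<lambda>l. \<epsilon> (l + k) * b k)"
        using \<epsilon>_sums[of k] by (intro summable_mult2) (auto simp: sums_iff)
      show "norm (a (l + k) * \<phi> (l + k) x) \<le> \<epsilon> (l + k) * b k" for l
        by (rule term_le) simp
    qed
    moreover have "(\<Sum>l. \<epsilon> (l + k) * b k) = (1/2) ^ k * b k"
      using sums_mult2[OF \<epsilon>_sums[of k], of "b k"] by (simp add: sums_iff)
    ultimately show ?thesis
      by simp
  qed
  have lip_\<psi>: "\<bar>\<psi> x - \<psi> y\<bar> \<le> N (x - y)" for x y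
  proof -
    have N: "N (x - y) \<ge> 0"
      using lip[of 0 x y] by linarith
    have "\<psi> x - \<psi> y = (\<Sum>k. a k * \<phi> k x - a k * \<phi> k y)"
      unfolding \<psi>_def by (intro suminf_diff summ)
    moreover have "norm (\<Sum>k. a k * \<phi> k x - a k * \<phi> k y) \<le> (\<Sum>k. \<epsilon> k * N (x - y))"
    proof (rule norm_suminf_le)
      show "summable (\<lambda>k. \<epsilon> k * N (x - y))"
        using \<epsilon>_sums[of 0] by (intro summable_mult2) (auto simp: sums_iff)
      show "norm (a k * \<phi> k x - a k * \<phi> k y) \<le> \<epsilon> k * N (x - y)" for k
        using a[of k] lip[of k x y] N \<epsilon>_pos[of k]
        by (auto simp: abs_mult right_diff_distrib[symmetric] intro!: mult_mono)
    qed
    moreover have "(\<Sum>k. \<epsilon> k * N (x - y)) = N (x - y)"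
      using sums_mult2[OF \<epsilon>_sums[of 0], of "N (x - y)"] by (simp add: sums_iff)
    ultimately show ?thesis
      by simp
  qed
  \<comment> \<open>As \<open>N\<close> is an arbitrary function here, \<open>lip_\<psi>\<close>
    says nothing about continuity, which comes from uniform convergence of the partial sums
    instead.\<close>
  have cont_\<psi>: "continuous_on S \<psi>"
  proof (rule uniform_limit_theorem[where f = \<Phi> and F = sequentially])
    show "uniform_limit S \<Phi> \<psi> sequentially"
    proof (rule uniform_limitI)
      fix r :: real assume "r > 0"
      have "(\<lambda>k. (1/2) ^ k * b 0) \<longlonglongrightarrow> 0 * b 0"
        by (intro tendsto_intros LIMSEQ_power_zero) auto
      then have "\<forall>\<^sub>F k in sequentially. (1/2) ^ k * b 0 < r"
        using \<open>r > 0\<close> by (simp add: order_tendstoD)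
      then show "\<forall>\<^sub>F k in sequentially. \<forall>x\<in>S. dist (\<Phi> k x) (\<psi> x) < r"
      proof eventually_elim
        case (elim k)
        have "(1/2) ^ k * b k \<le> (1/2) ^ k * b 0"
          using bound(2) by (intro mult_left_mono) (auto simp: decseq_def)
        moreover have "dist (\<Phi> k x) (\<psi> x) = \<bar>\<psi> x - \<Phi> k x\<bar>" for x
          by (simp add: dist_real_def abs_minus_commute)
        ultimately show ?case
          using elim tail[of _ k] by (metis le_less_trans order_trans)
      qed
    qed
  qed (auto intro: cont_\<Phi> always_eventually)
  \<comment> \<open>The terms after the k-th could undo what it gained. They amount to at most
    \<epsilon> k * b (Suc k), as (1/2)^(Suc k) is \<epsilon> k; hence the subtracted square, and the
    need for a next hump much flatter than the present error.\<close>
  have hard_\<psi>: "(1/4) ^ Suc k * (e k / 8 - (b (Suc k))\<^sup>2) \<le> (LINT x:S|lborel. (\<psi> x - val f x)\<^sup>2)"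
    if f: "norm f \<le> (1/2) ^ Suc k * t k / 2" for k f
  proof -
    have \<epsilon>2: "(\<epsilon> k)\<^sup>2 = (1/4) ^ Suc k"
      by (simp add: \<epsilon>_def power2_eq_square power_mult_distrib[symmetric])
    have "(\<epsilon> k)\<^sup>2 * e k / 4 \<le> (LINT x:S|lborel. (\<Phi> (Suc k) x - val f x)\<^sup>2)"
      using bad[of k] f by (simp add: bad_def \<epsilon>_def)
    also have "\<dots> = (LINT x:S|lborel. ((\<psi> x - val f x) + (\<Phi> (Suc k) x - \<psi> x))\<^sup>2)"
      by simp
    also have "\<dots> \<le> 2 * (LINT x:S|lborel. (\<psi> x - val f x)\<^sup>2) + 2 * (LINT x:S|lborel. (\<Phi> (Suc k) x - \<psi> x)\<^sup>2)"
      by (intro set_integral_power2_add_le S continuous_intros cont_val cont_\<Phi> cont_\<psi>)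
    also have "(LINT x:S|lborel. (\<Phi> (Suc k) x - \<psi> x)\<^sup>2) \<le> (\<epsilon> k * b (Suc k))\<^sup>2"
    proof (intro set_integral_le_const S continuous_intros cont_\<Phi> cont_\<psi>)
      show "(\<Phi> (Suc k) x - \<psi> x)\<^sup>2 \<le> (\<epsilon> k * b (Suc k))\<^sup>2" for x
        using tail[of x "Suc k"] b_nonneg[of "Suc k"] \<epsilon>_pos[of k]
        by (intro abs_le_square_iff[THEN iffD1]) (simp add: \<epsilon>_def abs_minus_commute)
    qed
    finally show ?thesis
      unfolding \<epsilon>2[symmetric] by (simp add: power_mult_distrib algebra_simps)
  qed
  show ?thesis
    using lip_\<psi> hard_\<psi> by blast
qed

section \<open>Grids of the unit cube\<close>

lemma content_box_shifted_cart:
  fixes a :: "real ^ 'd"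
  assumes "l \<ge> 0"
  shows "measure lborel (box a (a + (\<chi> i. l))) = l ^ CARD('d)"
proof -
  have "measure lborel (box a (a + (\<chi> i. l))) = measure lborel (cbox a (a + (\<chi> i. l)))"
    by (simp add: measure_lborel_box_eq measure_lborel_cbox_eq)
  also have "\<dots> = (\<Prod>i\<in>UNIV. (a + (\<chi> i. l)) $ i - a $ i)"
    using assms by (intro content_cbox_cart) (auto simp: interval_ne_empty_cart)
  finally show ?thesis
    by simp
qed

text \<open>Open cells are disjoint without any convention about faces, at the price of missing a
  null set. A core is the concentric box of half the side length. Moving by less than 1/(4m) in the
  Euclidean norm moves each coordinate by less than that, which is exactly the margin of a
  core.\<close>

lemma grid_cells:
  fixes m :: nat
  assumes m: "m \<ge> 1"
  obtains \<C> :: "(real ^ 'd) set set" and D :: "(real ^ 'd) set \<Rightarrow> (real ^ 'd) set"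
  where "finite \<C>" "disjoint \<C>" "card \<C> = m ^ CARD('d)"
    "\<And>c. c \<in> \<C> \<Longrightarrow> open c \<and> c \<subseteq> unit_cube \<and> measure lborel c = 1 / real m ^ CARD('d)"
    "\<And>c. c \<in> \<C> \<Longrightarrow> D c \<in> sets borel \<and> D c \<subseteq> c \<and> measure lborel (D c) = (1 / (2 * real m)) ^ CARD('d)"
    "\<And>c x. c \<in> \<C> \<Longrightarrow> x \<in> D c \<Longrightarrow> ball x (1 / (4 * real m)) \<subseteq> c"
proof -
  define p where "p c = (\<chi> i. real (c i) / real m)" for c :: "'d \<Rightarrow> nat"
  define cell where "cell c = box (p c) (p c + (\<chi> i. 1 / real m))" for c
  define core where "core c = box (p c + (\<chi> i. 1 / (4 * real m)))
    (p c + (\<chi> i. 1 / (4 * real m)) + (\<chi> i. 1 / (2 * real m)))" for c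
  define I where "I = (UNIV :: 'd set) \<rightarrow>\<^sub>E {..<m}"
  have cell_iff: "x \<in> cell c \<longleftrightarrow> (\<forall>i. real (c i) < real m * x $ i \<and> real m * x $ i < real (c i) + 1)" for x c
    using m by (simp add: cell_def p_def mem_box_cart field_simps)
  have unique: "c = c'" if "x \<in> cell c" "x \<in> cell c'" for x c c'
  proof
    fix i
    have "real (c i) < real (c' i) + 1" "real (c' i) < real (c i) + 1"
      using that unfolding cell_iff by (meson less_trans)+
    then show "c i = c' i"
      by linarith
  qed
  have ball: "ball x (1 / (4 * real m)) \<subseteq> cell c" if "x \<in> core c" for x c
  proof
    fix y assume "y \<in> ball x (1 / (4 * real m))"
    then have "\<bar>(y - x) $ i\<bar> < 1 / (4 * real m)" for i
      using component_le_norm_cart[of "y - x" i] by (simp add: dist_norm norm_minus_commute)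
    then have "real m * \<bar>y $ i - x $ i\<bar> < 1 / 4" for i
      using m by (simp add: field_simps)
    then have y: "\<bar>real m * y $ i - real m * x $ i\<bar> < 1 / 4" for i
      using m by (simp add: abs_mult right_diff_distrib[symmetric])
    have x: "real (c i) + 1 / 4 < real m * x $ i \<and> real m * x $ i < real (c i) + 3 / 4" for i
      using that m by (simp add: core_def p_def mem_box_cart field_simps)
    show "y \<in> cell c"
      unfolding cell_iff
    proof
      fix i
      show "real (c i) < real m * y $ i \<and> real m * y $ i < real (c i) + 1"
        using x[of i] y[of i] by linarith
    qed
  qed
  have core_ne: "core c \<noteq> {}" for c
    using m by (simp add: core_def interval_ne_empty_cart divide_strict_right_mono)
  have sub: "core c \<subseteq> cell c" for c
    using ball[of _ c] m by (force intro: centre_in_ball[THEN iffD2])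
  \<comment> \<open>Cells are nonempty because they contain their cores, so a cell determines its
    index. This lets \<open>inv_into\<close> turn the core into a function of the cell.\<close>
  have inj: "inj_on cell I"
    using unique sub core_ne by (metis (no_types, lifting) all_not_in_conv inj_onI subsetD)
  have inv: "inv_into I cell (cell c) = c" if "c \<in> I" for c
    using inj that by simp
  have cube: "cell c \<subseteq> unit_cube" if "c \<in> I" for c
  proof
    fix x assume x: "x \<in> cell c"
    show "x \<in> unit_cube"
      unfolding mem_box_cart
    proof
      fix i
      have "c i < m"
        using that by (auto simp: I_def)
      then have "real (c i) + 1 \<le> real m"
        by linarith
      moreover have "real (c i) < real m * x $ i" "real m * x $ i < real (c i) + 1"
        using x by (auto simp: cell_iff)
      ultimately have "0 < real m * x $ i" "real m * x $ i < real m * 1"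
        by linarith+
      then show "0 $ i \<le> x $ i \<and> x $ i \<le> 1 $ i"
        using m by (simp add: zero_less_mult_iff)
    qed
  qed
  show ?thesis
  proof
    show "finite (cell ` I)"
      by (simp add: I_def finite_PiE)
    show "card (cell ` I) = m ^ CARD('d)"
      using inj by (simp add: card_image I_def card_PiE)
    show "disjoint (cell ` I)"
    proof (rule disjointI)
      fix b b' assume "b \<in> cell ` I" "b' \<in> cell ` I" "b \<noteq> b'"
      then obtain c c' where "b = cell c" "b' = cell c'" "c \<noteq> c'"
        by blast
      then show "b \<inter> b' = {}"
        using unique by blast
    qed
    show "open c \<and> c \<subseteq> unit_cube \<and> measure lborel c = 1 / real m ^ CARD('d)" if "c \<in> cell ` I" for c
      using that cube content_box_shifted_cart[of "1 / real m"]
      by (auto simp: cell_def open_box power_one_over)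
    show "core (inv_into I cell c) \<in> sets borel \<and> core (inv_into I cell c) \<subseteq> c \<and>
        measure lborel (core (inv_into I cell c)) = (1 / (2 * real m)) ^ CARD('d)" if "c \<in> cell ` I" for c
      using that sub content_box_shifted_cart[of "1 / (2 * real m)"] by (auto simp: inv) (auto simp: core_def)
    show "ball x (1 / (4 * real m)) \<subseteq> c" if "c \<in> cell ` I" "x \<in> core (inv_into I cell c)" for c x
    proof -
      from that(1) obtain k where k: "k \<in> I" "c = cell k"
        by blast
      with that(2) show ?thesis
        using ball[of x k] by (simp add: inv)
    qed
  qed
qed

section \<open>Choice of scales and the limit superior\<close>

lemma Limsup_at_top_eq_infinity:
  fixes F :: "real \<Rightarrow> ereal" and s h :: "nat \<Rightarrow> real"
  assumes "filterlim s at_top sequentially" "filterlim h at_top sequentially"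
    and "\<forall>\<^sub>F k in sequentially. ereal (h k) \<le> F (s k)"
  shows "Limsup at_top F = \<infinity>"
proof (rule ccontr)
  assume "Limsup at_top F \<noteq> \<infinity>"
  then obtain r :: nat where "Limsup at_top F < ereal (real r)"
    using less_PInf_Ex_of_nat by (auto simp: less_top[symmetric] top_ereal_def)
  then have "\<forall>\<^sub>F t in at_top. F t < ereal (real r)"
    by (rule Limsup_lessD)
  then have "\<forall>\<^sub>F k in sequentially. F (s k) < ereal (real r)"
    using assms(1) by (rule eventually_compose_filterlim)
  moreover have "\<forall>\<^sub>F k in sequentially. real r \<le> h k"
    using assms(2) by (simp add: filterlim_at_top)
  ultimately have "\<forall>\<^sub>F k in sequentially. False"
    using assms(3)
  proof eventually_elim
    case (elim k)
    then show ?case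
      by (metis ereal_less_eq(3) leD order_trans)
  qed
  then show False
    by simp
qed

text \<open>A quadratic exponent beats every linear one; this is how the geometric losses of the
  gliding hump disappear in the limit.\<close>

lemma filterlim_two_powr_quadratic:
  fixes a p c :: real
  assumes "a > 0" "p > 0"
  shows "filterlim (\<lambda>k::nat. a * 2 powr (p * ((real k)\<^sup>2 + 1) - c * real k)) at_top sequentially"
  using assms by real_asymp

lemma hard_function_unit_cube:
  fixes val :: "'x::real_normed_vector \<Rightarrow> real ^ 'd \<Rightarrow> real" and C :: real
  assumes emb: "function_space_embedded_in_C unit_cube val"
    and iid: "iid_uniform_on unit_cube M {1..} X"
    and mc: "\<forall>n\<ge>1. (LINT \<omega>|M. (SUP f\<in>cball 0 1.
            (\<Sum>i=1..n. val f (X i \<omega>)) / real n - (LINT x:unit_cube|lborel. val f x)))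
          \<le> C / sqrt (real n)"
    and pos: "C > 0" "\<kappa> > 0" and m: "m \<ge> 1" "even m"
    and a: "a = \<kappa> / (8 * 2 ^ CARD('d))"
  shows "\<exists>\<phi>. (\<forall>x y. \<bar>\<phi> x - \<phi> y\<bar> \<le> \<kappa> * dist x y) \<and> (\<forall>x. \<bar>\<phi> x\<bar> \<le> \<kappa> / (4 * real m)) \<and>
    (\<forall>f. norm f \<le> a / (4 * sqrt 2 * C) * real m powr (real CARD('d) / 2 - 1) \<longrightarrow>
      (a / (6 * real m))\<^sup>2 \<le> (LINT x:unit_cube|lborel. (\<phi> x - val f x)\<^sup>2))"
proof -
  define n where "n = m ^ CARD('d) div 2"
  have two_n: "2 * n = m ^ CARD('d)"
    using m by (simp add: n_def)
  then have n: "n \<ge> 1"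
    using m by (cases n) auto
  have two_n_real: "2 * real n = real m ^ CARD('d)"
    using two_n by (metis of_nat_mult of_nat_numeral of_nat_power)
  have S: "compact (unit_cube :: (real ^ 'd) set)" "measure lborel (unit_cube :: (real ^ 'd) set) = 1"
    by (simp_all add: content_cbox_cart interval_ne_empty_cart)
  have "a > 0"
    using pos a by simp
  obtain \<C> :: "(real ^ 'd) set set" and D :: "(real ^ 'd) set \<Rightarrow> (real ^ 'd) set"
    where cells: "finite \<C>" "disjoint \<C>" "card \<C> = m ^ CARD('d)"
    "\<And>c. c \<in> \<C> \<Longrightarrow> open c \<and> c \<subseteq> unit_cube \<and> measure lborel c = 1 / real m ^ CARD('d)"
    "\<And>c. c \<in> \<C> \<Longrightarrow> D c \<in> sets borel \<and> D c \<subseteq> c \<and> measure lborel (D c) = (1 / (2 * real m)) ^ CARD('d)"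
    "\<And>c x. c \<in> \<C> \<Longrightarrow> x \<in> D c \<Longrightarrow> ball x (1 / (4 * real m)) \<subseteq> c"
    using grid_cells[OF m(1)] by metis
  define t where "t = a / (4 * sqrt 2 * C) * real m powr (real CARD('d) / 2 - 1)"
  have "t > 0"
    using \<open>a > 0\<close> pos m by (simp add: t_def)
  have "sqrt (real n) = sqrt (real m ^ CARD('d)) / sqrt 2"
    using two_n_real by (simp add: real_sqrt_divide[symmetric])
  also have "sqrt (real m ^ CARD('d)) = real m powr (real CARD('d) / 2)"
    using m by (simp add: powr_half_sqrt[symmetric] powr_realpow[symmetric] powr_powr)
  also have "\<dots> = real m powr (real CARD('d) / 2 - 1) * real m"
    using m by (simp add: powr_diff)
  finally have sqrt_n: "sqrt (real n) = real m powr (real CARD('d) / 2 - 1) * real m / sqrt 2" .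
  have q: "real m powr (real CARD('d) / 2 - 1) > 0"
    using m by simp
  have e1: "t * (C / sqrt (real n)) = a / (4 * real m)"
    unfolding t_def sqrt_n using pos m q by (simp add: field_simps)
  have e2: "\<kappa> * (1 / (4 * real m)) * (1 / (2 * real m)) ^ CARD('d) * real n = a / real m"
  proof -
    have n_eq: "real n = real m ^ CARD('d) / 2"
      using two_n_real by simp
    show ?thesis
      unfolding n_eq a using m by (simp add: power_divide power_mult_distrib)
  qed
  have gap: "t * (C / sqrt (real n)) + 3 * (a / (6 * real m))
      < \<kappa> * (1 / (4 * real m)) * (1 / (2 * real m)) ^ CARD('d) * real n"
    unfolding e1 e2 using \<open>a > 0\<close> m by (simp add: field_simps)
  have card: "card \<C> = 2 * n"
    using cells(3) two_n by simp
  have cell: "open c \<and> c \<subseteq> unit_cube \<and> measure lborel c = 1 / (2 * real n)" if "c \<in> \<C>" for c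
    using cells(4)[OF that] unfolding two_n_real .
  have "1 / (4 * real m) > 0" "a / (6 * real m) > 0"
    using \<open>a > 0\<close> m by auto
  from hard_lipschitz_function[OF S emb iid n mc[rule_format, OF n] cells(1,2) card cell cells(5,6)
      this(1) pos(2) \<open>t > 0\<close> this(2) gap]
  show ?thesis
    by (simp only: t_def times_divide_eq_right mult_1_right)
qed

theorem corollary3p4:
  fixes N :: "real ^ 'd \<Rightarrow> real"
    and val :: "'x::banach \<Rightarrow> real ^ 'd \<Rightarrow> real"
    and M :: "'w measure"
    and X :: "nat \<Rightarrow> 'w \<Rightarrow> real ^ 'd"
    and C :: real
  assumes "CARD('d) \<ge> 3"
    and "is_norm N"
    and "function_space_embedded_in_C unit_cube val"
    and "iid_uniform_on unit_cube M {1..} X"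
    and "\<forall>n\<ge>1. (LINT \<omega>|M. (SUP f\<in>cball 0 1.
            (\<Sum>i=1..n. val f (X i \<omega>)) / real n - (LINT x:unit_cube|lborel. val f x)))
          \<le> C / sqrt (real n)"
  shows "\<exists>\<phi> :: real ^ 'd \<Rightarrow> real.
           (\<forall>x\<in>unit_cube. \<forall>y\<in>unit_cube. \<bar>\<phi> x - \<phi> y\<bar> \<le> N (x - y)) \<and>
           (\<forall>\<gamma> > 4 / (real CARD('d) - 2).
              Limsup at_top (\<lambda>t::real. ereal (t powr \<gamma> *
                (INF f\<in>{f. norm f \<le> t}. (L2_norm_on unit_cube (\<lambda>x. \<phi> x - val f x))\<^sup>2))) = \<infinity>)"
proof -
  define Q where "Q = (unit_cube :: (real ^ 'd) set)"
  \<comment> \<open>\<open>C\<close> may be zero or negative, but the radii are obtained by dividing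
    by it.\<close>
  define C' where "C' = max C 1"
  define q where "q = real CARD('d) / 2 - 1"
  \<comment> \<open>The quadratic exponent serves two ends: the ratio of consecutive grid sizes,
    2^(2k+1), tends to infinity, so the next hump is negligible, while 2^k stays below every power
    of \<open>m k\<close> eventually. The summand 1 makes \<open>m 0\<close> even.\<close>
  define m :: "nat \<Rightarrow> nat" where "m k = 2 ^ (k\<^sup>2 + 1)" for k
  obtain \<kappa> where \<kappa>: "\<kappa> > 0" "\<And>x. \<kappa> * norm x \<le> N x"
    using is_norm_lower_bound[OF assms(2)] by blast
  define a where "a = \<kappa> / (8 * 2 ^ CARD('d))"
  define t where "t k = a / (4 * sqrt 2 * C') * real (m k) powr q" for k
  have "a > 0" "C' > 0" "q > 0"
    using \<kappa>(1) assms(1) by (auto simp: a_def C'_def q_def)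
  have m: "m k \<ge> 1" "even (m k)" for k
    by (auto simp: m_def)
  have m_powr: "real (m k) = 2 powr ((real k)\<^sup>2 + 1)" for k
    by (simp add: m_def powr_add powr_realpow[symmetric])
  have "C / sqrt (real n) \<le> C' / sqrt (real n)" for n
    by (intro divide_right_mono) (auto simp: C'_def)
  then have mc: "\<forall>n\<ge>1. (LINT \<omega>|M. (SUP f\<in>cball 0 1.
            (\<Sum>i=1..n. val f (X i \<omega>)) / real n - (LINT x:unit_cube|lborel. val f x)))
          \<le> C' / sqrt (real n)"
    by (intro allI impI order_trans[OF assms(5)[rule_format]])
  have "\<exists>\<phi>. \<forall>k. (\<forall>x y. \<bar>\<phi> k x - \<phi> k y\<bar> \<le> \<kappa> * dist x y) \<and> (\<forall>x. \<bar>\<phi> k x\<bar> \<le> \<kappa> / (4 * real (m k))) \<and>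
      (\<forall>f. norm f \<le> t k \<longrightarrow> (a / (6 * real (m k)))\<^sup>2 \<le> (LINT x:Q|lborel. (\<phi> k x - val f x)\<^sup>2))"
    unfolding t_def q_def Q_def
    by (intro choice allI hard_function_unit_cube[OF assms(3,4) mc \<open>C' > 0\<close> \<kappa>(1) m a_def])
  then obtain \<phi> where \<phi>: "\<And>k x y. \<bar>\<phi> k x - \<phi> k y\<bar> \<le> \<kappa> * dist x y" "\<And>k x. \<bar>\<phi> k x\<bar> \<le> \<kappa> / (4 * real (m k))"
    "\<And>k f. norm f \<le> t k \<Longrightarrow> (a / (6 * real (m k)))\<^sup>2 \<le> (LINT x:Q|lborel. (\<phi> k x - val f x)\<^sup>2)"
    by blast
  have lip: "\<bar>\<phi> k x - \<phi> k y\<bar> \<le> N (x - y)" for k x y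
    using \<phi>(1)[of k x y] \<kappa>(2)[of "x - y"] by (simp add: dist_norm)
  have "\<kappa>-lipschitz_on Q (\<phi> k)" for k
    using \<phi>(1) \<kappa>(1) by (intro lipschitz_onI) (auto simp: dist_real_def)
  then have cont: "continuous_on Q (\<phi> k)" for k
    using lipschitz_on_continuous_on by blast
  have dec: "decseq (\<lambda>k. \<kappa> / (4 * real (m k)))"
  proof (rule decseq_SucI)
    fix k
    have "real (m k) \<le> real (m (Suc k))"
      unfolding m_def of_nat_le_iff by (intro power_increasing) (auto simp: power2_eq_square)
    moreover have "real (m k) > 0"
      by (simp add: m_def)
    ultimately show "\<kappa> / (4 * real (m (Suc k))) \<le> \<kappa> / (4 * real (m k))"
      using \<kappa>(1) by (intro divide_left_mono) auto
  qed
  have S: "compact Q" "measure lborel Q = 1"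
    by (simp_all add: Q_def content_cbox_cart interval_ne_empty_cart)
  define s where "s k = (1/2) ^ Suc k * t k / 2" for k
  define E where "E k = (1/4) ^ Suc k * ((a / (6 * real (m k)))\<^sup>2 / 8 - (\<kappa> / (4 * real (m (Suc k))))\<^sup>2)" for k
  obtain \<psi> where \<psi>: "\<And>x y. \<bar>\<psi> x - \<psi> y\<bar> \<le> N (x - y)"
    "\<And>k f. norm f \<le> s k \<Longrightarrow> E k \<le> (LINT x:Q|lborel. (\<psi> x - val f x)\<^sup>2)"
    using gliding_hump[OF S assms(3)[folded Q_def] lip cont \<phi>(2) dec \<phi>(3)] unfolding s_def E_def by blast

  define A where "A = a / (16 * sqrt 2 * C')"
  have "A > 0"
    using \<open>a > 0\<close> \<open>C' > 0\<close> by (simp add: A_def)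
  have half_pow: "(1/2) ^ k = 2 powr (- real k)" for k
    by (simp add: powr_minus powr_realpow power_one_over inverse_eq_divide)
  have s_eq: "s k = A * 2 powr (q * ((real k)\<^sup>2 + 1) - 1 * real k)" for k
  proof -
    have "s k = A * ((1/2) ^ k * real (m k) powr q)"
      by (simp add: s_def t_def A_def mult_ac)
    also have "(1/2) ^ k * real (m k) powr q = 2 powr (q * ((real k)\<^sup>2 + 1) - 1 * real k)"
      unfolding half_pow m_powr powr_powr by (simp add: powr_add[symmetric] mult.commute)
    finally show ?thesis .
  qed
  have s_lim: "filterlim s at_top sequentially"
    unfolding s_eq using \<open>A > 0\<close> \<open>q > 0\<close> by (rule filterlim_two_powr_quadratic)
  \<comment> \<open>The power of 1/4 is the squared ratio of consecutive grid sizes. The main term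
    of \<open>E k\<close> carries a^2 / (36 * 8) = a^2 / 288, so eventually the tail uses up at most
    half of it; the remaining a^2 / 576 becomes a^2 / 2304 with one more factor 1/4 from
    \<open>(1/4) ^ Suc k\<close>.\<close>
  have "((\<lambda>k::nat. \<kappa>\<^sup>2 / 16 * (1/4) powr (2 * real k + 1)) \<longlongrightarrow> 0) sequentially"
    by real_asymp
  moreover have "0 < a\<^sup>2 / 576"
    using \<open>a > 0\<close> by simp
  ultimately have "\<forall>\<^sub>F k in sequentially. \<kappa>\<^sup>2 / 16 * (1/4) powr (2 * real k + 1) < a\<^sup>2 / 576"
    by (rule order_tendstoD)
  then have E_ge: "\<forall>\<^sub>F k in sequentially. a\<^sup>2 / 2304 * 2 powr (- 2 * ((real k)\<^sup>2 + 1) - 2 * real k) \<le> E k"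
  proof eventually_elim
    case (elim k)
    define z where "z = 2 powr (- 2 * ((real k)\<^sup>2 + 1))"
    have "z \<ge> 0"
      by (simp add: z_def)
    have inv_m: "1 / (real (m j))\<^sup>2 = 2 powr (- 2 * ((real j)\<^sup>2 + 1))" for j
    proof -
      have "1 / (2 powr u)\<^sup>2 = 2 powr (- 2 * u)" for u :: real
        by (simp add: powr_power powr_minus_divide mult.commute)
      then show ?thesis
        unfolding m_powr .
    qed
    have sq_div: "(x / (c * y))\<^sup>2 = x\<^sup>2 / c\<^sup>2 * (1 / y\<^sup>2)" for x c y :: real
      by (simp add: power_divide power_mult_distrib)
    have quarter: "(1/4 :: real) = 2 powr (- 2)"
      by (simp add: powr_minus)
    have "1 / (real (m (Suc k)))\<^sup>2 = z * (1/4) powr (2 * real k + 1)"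
      unfolding inv_m z_def quarter powr_powr
      by (simp add: powr_add[symmetric] power2_eq_square algebra_simps)
    then have "(\<kappa> / (4 * real (m (Suc k))))\<^sup>2 = z * (\<kappa>\<^sup>2 / 16 * (1/4) powr (2 * real k + 1))"
      unfolding sq_div by simp
    also have "\<dots> \<le> z * (a\<^sup>2 / 576)"
      using elim \<open>z \<ge> 0\<close> by (intro mult_left_mono) auto
    finally have "(\<kappa> / (4 * real (m (Suc k))))\<^sup>2 \<le> z * (a\<^sup>2 / 576)" .
    moreover have "(a / (6 * real (m k)))\<^sup>2 / 8 = z * (a\<^sup>2 / 288)"
      unfolding sq_div inv_m z_def by simp
    ultimately have "(1/4) ^ Suc k * (z * (a\<^sup>2 / 576)) \<le> E k"
      unfolding E_def by (intro mult_left_mono) auto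
    moreover have "(1/4 :: real) ^ k = 2 powr (- 2 * real k)"
      by (subst quarter) (simp add: powr_power mult.commute)
    moreover have "2 powr (- 2 * ((real k)\<^sup>2 + 1) - 2 * real k) = z * 2 powr (- 2 * real k)"
      by (simp add: z_def powr_add[symmetric])
    ultimately show ?case
      by (simp add: mult_ac)
  qed

  have limsup: "Limsup at_top (\<lambda>t::real. ereal (t powr \<gamma> *
      (INF f\<in>{f. norm f \<le> t}. (L2_norm_on unit_cube (\<lambda>x. \<psi> x - val f x))\<^sup>2))) = \<infinity>"
    if \<gamma>: "\<gamma> > 4 / (real CARD('d) - 2)" for \<gamma>
  proof (rule Limsup_at_top_eq_infinity[OF s_lim])
    \<comment> \<open>This is the condition on \<gamma> rewritten: \<open>s k\<close> grows like the
      power q = (d-2)/2 of the grid size and the squared error decays like its inverse square, both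
      up to factors exponential in k.\<close>
    have "\<gamma> * q - 2 > 0"
      using \<gamma> assms(1) by (simp add: q_def field_simps)
    then show "filterlim (\<lambda>k. A powr \<gamma> * (a\<^sup>2 / 2304) * 2 powr ((\<gamma> * q - 2) * ((real k)\<^sup>2 + 1) - (\<gamma> + 2) * real k))
        at_top sequentially"
      using \<open>A > 0\<close> \<open>a > 0\<close> by (intro filterlim_two_powr_quadratic) auto
    show "\<forall>\<^sub>F k in sequentially.
        ereal (A powr \<gamma> * (a\<^sup>2 / 2304) * 2 powr ((\<gamma> * q - 2) * ((real k)\<^sup>2 + 1) - (\<gamma> + 2) * real k))
        \<le> ereal (s k powr \<gamma> * (INF f\<in>{f. norm f \<le> s k}. (L2_norm_on unit_cube (\<lambda>x. \<psi> x - val f x))\<^sup>2))"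
      using E_ge
    proof eventually_elim
      case (elim k)
      have "s k \<ge> 0"
        using \<open>A > 0\<close> by (simp add: s_eq)
      have sq: "(L2_norm_on unit_cube g)\<^sup>2 = (LINT x:Q|lborel. (g x)\<^sup>2)" for g :: "real ^ 'd \<Rightarrow> real"
        unfolding L2_norm_on_def Q_def
        by (intro real_sqrt_pow2) (simp add: set_lebesgue_integral_def)
      have "E k \<le> (INF f\<in>{f. norm f \<le> s k}. (L2_norm_on unit_cube (\<lambda>x. \<psi> x - val f x))\<^sup>2)"
      proof (rule cINF_greatest)
        show "{f :: 'x. norm f \<le> s k} \<noteq> {}"
          using \<open>s k \<ge> 0\<close> by (auto intro!: exI[of _ 0])
      qed (simp add: sq \<psi>(2))
      with elim have "a\<^sup>2 / 2304 * 2 powr (- 2 * ((real k)\<^sup>2 + 1) - 2 * real k)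
          \<le> (INF f\<in>{f. norm f \<le> s k}. (L2_norm_on unit_cube (\<lambda>x. \<psi> x - val f x))\<^sup>2)"
        by (rule order_trans)
      then have "s k powr \<gamma> * (a\<^sup>2 / 2304 * 2 powr (- 2 * ((real k)\<^sup>2 + 1) - 2 * real k))
          \<le> s k powr \<gamma> * (INF f\<in>{f. norm f \<le> s k}. (L2_norm_on unit_cube (\<lambda>x. \<psi> x - val f x))\<^sup>2)"
        by (intro mult_left_mono) auto
      moreover have "s k powr \<gamma> = A powr \<gamma> * 2 powr (\<gamma> * (q * ((real k)\<^sup>2 + 1) - real k))"
        using \<open>A > 0\<close> by (simp add: s_eq powr_mult powr_powr mult.commute)
      moreover have "A powr \<gamma> * 2 powr (\<gamma> * (q * ((real k)\<^sup>2 + 1) - real k)) * (a\<^sup>2 / 2304 * 2 powr (- 2 * ((real k)\<^sup>2 + 1) - 2 * real k))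
          = A powr \<gamma> * (a\<^sup>2 / 2304) * 2 powr ((\<gamma> * q - 2) * ((real k)\<^sup>2 + 1) - (\<gamma> + 2) * real k)"
      proof -
        have "(\<gamma> * q - 2) * ((real k)\<^sup>2 + 1) - (\<gamma> + 2) * real k
            = \<gamma> * (q * ((real k)\<^sup>2 + 1) - real k) + (- 2 * ((real k)\<^sup>2 + 1) - 2 * real k)"
          by (simp add: algebra_simps)
        then show ?thesis
          by (simp only: powr_add mult_ac)
      qed
      ultimately show ?case
        by (simp only: ereal_less_eq(3))
    qed
  qed
  show ?thesis
    using \<psi>(1) limsup by blast
qed

end
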